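(* For $d\ge 3$, $\alpha>0$ and $\kappa=0$, there exists $c=c(d)>0$ such that for all $n\ge 1$, $$\mathbb{P}\big[0\overset{\mathcal{L}_{\alpha}}{\longleftrightarrow}\partial B(0,n)\big]\ \ge\ \mathbb{P}\big[\exists\,\ell\in\mathcal{L}_{\alpha}:\ \ell\text{ intersects both }0\text{ and }\partial B(0,n)\big]\ \ge\ \alpha\cdot c\cdot n^{2-d}.$$
   Context: Let $Q=(Q^x_y)_{x,y}$ be the transition matrix of simple random walk on $\mathbb{Z}^d$. A based loop is an element $\dot\ell=(x_1,\dots,x_n)\in(\mathbb{Z}^d)^n$, $n\ge 2$, with $x_1\ne x_2,\dots,x_{n-1}\neq x_n,x_n\ne x_1$; loops are equivalence classes of based loops under circular permutation. Put $\dot\mu(\dot\ell)=\frac1n Q^{x_1}_{x_2}\cdots Q^{x_{n-1}}_{x_n}Q^{x_n}_{x_1}$ (this is the case $\kappa=0$ of the weight $\dot\mu_\kappa(\dot\ell)=\frac1n(1+\kappa)^{-n} Q^{x_1}_{x_2}\cdots Q^{x_{n-1}}_{x_n}Q^{x_n}_{x_1}$) and let $\mu$ be the push-forward of $\dot\mu$ to the space of loops. For $\alpha>0$, $\mathcal{L}_\alpha=\mathcal{L}_{\alpha,0}$ is the Poisson point process of loops with intensity $\alpha\mu$. An edge of $\mathbb{Z}^d$ is open if it is traversed by at least one loop of $\mathcal{L}_\alpha$ (a loop $(x_1,\dots,x_n)$ traverses $\{x_i,x_{i+1}\}$ and $\{x_n,x_1\}$). For vertex sets $A,B$ (or single vertices),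 $A\overset{\mathcal{L}_\alpha}{\longleftrightarrow}B$ means that some $x\in A$ and $y\in B$ are connected by a path of open edges (a vertex is connected to itself). A loop intersects a vertex or a vertex set if it visits that vertex, respectively at least one vertex of that set. $B(x,n)=\{y:\|y-x\|_\infty\le n\}$ is the box of side length $2n$ centered at $x$, and $\partial F=\{x\in F:\ x\text{ has a neighbour outside }F\}$.
   Formalization: A constant c depending on d alone cannot serve all α>0, since n=1 would force αc≤1. The formal statement fixes any A>0 and gives c>0 depending on d and A, valid for all 0<α≤A and all n≥1. *)

theory Defs
  imports "HOL-Probability.Probability"
begin

section \<open>The lattice and simple random walk\<close>

definition neighbours :: "int ^ 'd \<Rightarrow> int ^ 'd \<Rightarrow> bool" where
  "neighbours x y \<longleftrightarrow> (\<Sum>i\<in>UNIV. \<bar>x $ i - y $ i\<bar>) = 1"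

definition srw_trans :: "int ^ 'd \<Rightarrow> int ^ 'd \<Rightarrow> real" where
  "srw_trans x y = (if neighbours x y then 1 / (2 * real CARD('d)) else 0)"

definition sup_norm :: "int ^ 'd \<Rightarrow> int" where
  "sup_norm x = Max (range (\<lambda>i. \<bar>x $ i\<bar>))"

definition lattice_box :: "int ^ 'd \<Rightarrow> nat \<Rightarrow> (int ^ 'd) set" where
  "lattice_box x n = {y. sup_norm (y - x) \<le> int n}"

definition inner_boundary :: "(int ^ 'd) set \<Rightarrow> (int ^ 'd) set" where
  "inner_boundary F = {x \<in> F. \<exists>y. neighbours x y \<and> y \<notin> F}"


section \<open>Loops and the loop measure\<close>

definition based_loops :: "'v list set" where
  "based_loops = {xs. 2 \<le> length xs \<and>
     (\<forall>i < length xs. xs ! i \<noteq> xs ! (Suc i mod length xs))}"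

definition rotation_rel :: "('v list \<times> 'v list) set" where
  "rotation_rel = {(xs, ys). xs \<in> based_loops \<and> ys \<in> based_loops \<and> (\<exists>k. ys = rotate k xs)}"

definition loops :: "'v list set set" where
  "loops = based_loops // rotation_rel"

definition based_loop_weight :: "real \<Rightarrow> (int ^ 'd) list \<Rightarrow> real" where
  "based_loop_weight \<kappa> xs =
     1 / real (length xs) * (1 / (1 + \<kappa>) ^ length xs) *
     (\<Prod>i < length xs. srw_trans (xs ! i) (xs ! (Suc i mod length xs)))"

definition based_loop_measure :: "real \<Rightarrow> (int ^ 'd) list measure" where
  "based_loop_measure \<kappa> = point_measure based_loops (\<lambda>xs. ennreal (based_loop_weight \<kappa> xs))"

definition loop_measure :: "real \<Rightarrow> (int ^ 'd) list set measure" where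
  "loop_measure \<kappa> = distr (based_loop_measure \<kappa>) (count_space loops) (\<lambda>xs. rotation_rel `` {xs})"

definition loop_visits :: "'v list set \<Rightarrow> 'v set \<Rightarrow> bool" where
  "loop_visits l F \<longleftrightarrow> (\<exists>xs\<in>l. set xs \<inter> F \<noteq> {})"

definition loop_traverses :: "'v list set \<Rightarrow> 'v set \<Rightarrow> bool" where
  "loop_traverses l e \<longleftrightarrow> (\<exists>xs\<in>l. \<exists>i < length xs. e = {xs ! i, xs ! (Suc i mod length xs)})"


section \<open>Poisson point processes\<close>

text \<open>
  A realisation \<open>N \<omega>\<close> is a counting measure, so that multiplicities are recorded. The Poisson
  distribution is written out because \<open>poisson_pmf\<close> is only specified for positive rates,
  while \<open>M A = 0\<close> has to be allowed; the formula then gives the point mass at \<open>0\<close>.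
\<close>

locale poisson_point_process = prob_space \<Omega>
  for \<Omega> :: "'w measure" +
  fixes M :: "'a measure" and N :: "'w \<Rightarrow> 'a measure"
  assumes sets_realisation: "\<omega> \<in> space \<Omega> \<Longrightarrow> sets (N \<omega>) = sets M"
    and counting: "\<omega> \<in> space \<Omega> \<Longrightarrow> A \<in> sets M \<Longrightarrow> emeasure (N \<omega>) A \<in> range ennreal_of_enat"
    and measurable_count:
      "A \<in> sets M \<Longrightarrow> (\<lambda>\<omega>. emeasure (N \<omega>) A) \<in> borel_measurable \<Omega>"
    and poisson_count:
      "A \<in> sets M \<Longrightarrow> emeasure M A < \<infinity> \<Longrightarrow>
         \<P>(\<omega> in \<Omega>. emeasure (N \<omega>) A = of_nat k) = measure M A ^ k / fact k * exp (- measure M A)"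
    and infinite_count:
      "A \<in> sets M \<Longrightarrow> emeasure M A = \<infinity> \<Longrightarrow> AE \<omega> in \<Omega>. emeasure (N \<omega>) A = \<infinity>"
    and independent_counts:
      "\<A> \<subseteq> sets M \<Longrightarrow> finite \<A> \<Longrightarrow> disjoint \<A> \<Longrightarrow>
         indep_vars (\<lambda>_. borel) (\<lambda>A \<omega>. emeasure (N \<omega>) A) \<A>"

definition points :: "'a measure \<Rightarrow> 'a set" where
  "points \<nu> = {x \<in> space \<nu>. emeasure \<nu> {x} > 0}"

definition loop_soup ::
    "real \<Rightarrow> real \<Rightarrow> 'w measure \<Rightarrow> ('w \<Rightarrow> (int ^ 'd) list set measure) \<Rightarrow> bool" where
  "loop_soup \<alpha> \<kappa> \<Omega> \<L> \<longleftrightarrow>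
     poisson_point_process \<Omega> (scale_measure (ennreal \<alpha>) (loop_measure \<kappa>)) \<L>"


section \<open>Loop percolation\<close>

definition open_edges :: "(int ^ 'd) list set set \<Rightarrow> ((int ^ 'd) \<times> (int ^ 'd)) set" where
  "open_edges L = {(x, y). neighbours x y \<and> (\<exists>l\<in>L. loop_traverses l {x, y})}"

definition connected_by ::
    "(int ^ 'd) list set set \<Rightarrow> (int ^ 'd) set \<Rightarrow> (int ^ 'd) set \<Rightarrow> bool" where
  "connected_by L A B \<longleftrightarrow> (\<exists>x\<in>A. \<exists>y\<in>B. (x, y) \<in> (open_edges L)\<^sup>*)"

end

theory Submission
  imports Defs
begin

text \<open>
  The number of loops of the soup that visit the origin and the sphere of radius \<open>n\<close> is Poisson, so
  everything reduces to bounding the loop measure of such loops from below by a multiple of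
  \<open>n powi (2 - d)\<close>. The rotations of an excursion \<open>0 # ys\<close> from the origin with \<open>0 \<notin> set ys\<close> are distinct
  based loops, so this measure is at least the weight \<open>W\<close> of the excursions reaching distance \<open>n\<close>.
  Cutting a closed path at its visits to the origin around a far point shows that closed paths
  reaching distance \<open>n\<close> have total weight at most \<open>G(0) W G(0)\<close>, where \<open>G\<close> is the Green function. On the
  other hand, looking at the position \<open>z\<close> at a Poisson time \<open>t\<close> of order \<open>n\<^sup>2\<close>, this weight is at least
  the sum of \<open>h\<^sub>t(z) G(z)\<close> over \<open>z \<in> {n..2n}\<^sup>d\<close>, where \<open>h\<^sub>t\<close> is the heat kernel in continuous time, and \<open>G\<close> is
  the integral of \<open>h\<^sub>t\<close> over \<open>t\<close>. Since \<open>h\<^sub>t\<close> is a product of one-dimensional kernels, it suffices to show that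
  the latter are of order \<open>t powr (-1/2)\<close> up to distance of order \<open>sqrt t\<close>; this follows from the central
  binomial coefficient, monotonicity in \<open>\<bar>k\<bar>\<close> and the variance.
\<close>


section \<open>One-dimensional simple random walk\<close>

fun line_walk :: "nat \<Rightarrow> int \<Rightarrow> real" where
  "line_walk 0 k = of_bool (k = 0)"
| "line_walk (Suc m) k = (line_walk m (k - 1) + line_walk m (k + 1)) / 2"

lemma line_walk_nonneg: "0 \<le> line_walk m k"
  by (induction m arbitrary: k) auto

lemma line_walk_le_1: "line_walk m k \<le> 1"
proof (induction m arbitrary: k)
  case (Suc m)
  show ?case using Suc[of "k-1"] Suc[of "k+1"] by simp
qed auto

lemma line_walk_minus: "line_walk m (- k) = line_walk m k"
proof (induction m arbitrary: k)
  case (Suc m)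
  have "- k - 1 = - (k + 1)" "- k + 1 = - (k - 1)" by simp_all
  then show ?case by (simp only: line_walk.simps Suc.IH add.commute)
qed auto

lemma line_walk_eq_0: "int m < \<bar>k\<bar> \<Longrightarrow> line_walk m k = 0"
  by (induction m arbitrary: k) auto

text \<open>With j steps up the position is 2j - m. For j > m both sides vanish, so Pascal's rule
  needs no separate case at the right end.\<close>

lemma line_walk_binomial: "line_walk m (2 * int j - int m) = real (m choose j) / 2 ^ m"
proof (induction m arbitrary: j)
  case 0
  then show ?case by (cases j) auto
next
  case (Suc m)
  show ?case
  proof (cases j)
    case 0
    have "line_walk m (- 2 - int m) = 0" by (rule line_walk_eq_0) simp
    moreover have "line_walk m (- int m) = 1 / 2 ^ m" using Suc[of 0] by simp
    moreover have "2 * int j - int (Suc m) - 1 = - 2 - int m" "2 * int j - int (Suc m) + 1 = - int m"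
      using 0 by auto
    ultimately show ?thesis using 0 by simp
  next
    case (Suc i)
    have "line_walk m (2 * int i - int m) = real (m choose i) / 2 ^ m" by (rule Suc.IH)
    moreover have "line_walk m (2 * int i - int m + 2) = real (m choose Suc i) / 2 ^ m" 
      using Suc.IH[of "Suc i"] by (simp add: algebra_simps)
    moreover have "2 * int j - int (Suc m) - 1 = 2 * int i - int m"
      "2 * int j - int (Suc m) + 1 = 2 * int i - int m + 2"
      using Suc by auto
    ultimately show ?thesis using Suc by (simp add: field_simps)
  qed
qed

text \<open>The left side is 1 at \<open>m = 0\<close> and decreases: consecutive values have ratio
  (2m+1)(2m+3)/(2m+2)^2 < 1. This yields the order m^(-1/2) without Stirling's formula.\<close>

lemma central_binomial_upper_bound:
  "(real (2 * m choose m) / 4 ^ m)\<^sup>2 * (2 * real m + 1) \<le> 1"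
proof (induction m)
  case (Suc m)
  define a where "a = real (2 * m choose m) / 4 ^ m"
  \<comment> \<open>Two absorption identities, linked by the symmetry of row 2m+1.\<close>
  have 1: "(2 * Suc m choose Suc m) * (m + 1) = 2 * (2 * m + 1) * (2 * m choose m)"
  proof -
    have "Suc m * (2 * Suc m choose Suc m) = (2 * Suc m) * (Suc (2*m) choose m)"
      using Suc_times_binomial_eq[of "Suc (2*m)" m] by simp
    moreover have "Suc (2*m) choose m = Suc (2*m) choose Suc m"
      using binomial_symmetric[of m "Suc (2*m)"] by simp
    moreover have "Suc m * (Suc (2*m) choose Suc m) = Suc (2*m) * (2*m choose m)"
      using Suc_times_binomial_eq[of "2*m" m] by simp
    ultimately have "Suc m * (2 * Suc m choose Suc m) = 2 * (Suc (2*m) * (2*m choose m))"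
      by (metis mult.assoc)
    thus ?thesis by (simp only: mult.commute mult.assoc Suc_eq_plus1)
  qed
  have h: "real (2 * Suc m choose Suc m) * (real m + 1) = 2 * (2 * real m + 1) * real (2 * m choose m)"
    using arg_cong[OF 1, of real] by (simp only: of_nat_mult of_nat_add of_nat_1 of_nat_numeral)
  have "real (2 * Suc m choose Suc m) / 4 ^ Suc m = a * ((2 * real m + 1) / (2 * real m + 2))"
  proof -
    have "b' / (4 * p) = b / p * ((2 * x + 1) / (2 * x + 2))"
      if "b' * (x + 1) = 2 * (2 * x + 1) * b" "0 \<le> x" "0 < p" for b b' p x :: real
      using that by (simp add: divide_simps) (simp add: algebra_simps)
    from this[OF h, of "4 ^ m"] show ?thesis unfolding a_def by simp
  qed
  moreover have "(a * (p / r))\<^sup>2 * q = (a\<^sup>2 * p) * (p * q / r\<^sup>2)" for p q r :: real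
    by (simp add: power2_eq_square)
  ultimately have "(real (2 * Suc m choose Suc m) / 4 ^ Suc m)\<^sup>2 * (2 * real (Suc m) + 1)
     = (a\<^sup>2 * (2 * real m + 1)) * ((2 * real m + 1) * (2 * real (Suc m) + 1) / (2 * real m + 2)\<^sup>2)"
    by presburger
  also have "(2 * real m + 1) * (2 * real (Suc m) + 1) / (2 * real m + 2)\<^sup>2 \<le> 1"
    by (subst divide_le_eq_1_pos) (auto simp: power2_eq_square algebra_simps intro!: add_pos_nonneg)
  hence "(a\<^sup>2 * (2 * real m + 1)) * ((2 * real m + 1) * (2 * real (Suc m) + 1) / (2 * real m + 2)\<^sup>2) \<le> 1 * 1"
    using Suc.IH unfolding a_def[symmetric] by (intro mult_mono) auto
  finally show ?case by simp
qed auto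

text \<open>Even times reduce to the central binomial coefficient; at odd times the value is zero by
  parity.\<close>

lemma line_walk_origin_le: "line_walk m 0 \<le> 1 / sqrt (real m + 1)"
proof (cases "even m")
  case True
  then obtain j where j: "m = 2 * j" by auto
  have eq: "line_walk m 0 = real (2 * j choose j) / 4 ^ j"
    using line_walk_binomial[of m j] by (simp add: j power_mult)
  have "(line_walk m 0)\<^sup>2 * (real m + 1) \<le> 1"
    using central_binomial_upper_bound[of j] unfolding eq by (simp add: j)
  hence "(line_walk m 0)\<^sup>2 \<le> 1 / (real m + 1)" by (simp add: field_simps)
  hence "line_walk m 0 \<le> sqrt (1 / (real m + 1))" by (rule real_le_rsqrt)
  thus ?thesis by (simp add: real_sqrt_divide)
next
  case False
  have "odd (int m + k) \<Longrightarrow> line_walk m k = 0" for k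
    by (induction m arbitrary: k) auto
  from this[of 0] False show ?thesis by simp
qed

lemma nn_integral_count_space_int_shift:
  fixes f :: "int \<Rightarrow> ennreal"
  shows "(\<integral>\<^sup>+k. f (k + c) \<partial>count_space UNIV) = (\<integral>\<^sup>+k. f k \<partial>count_space UNIV)"
  by (rule nn_integral_bij_count_space) (rule bij_betwI[where g="\<lambda>k. k - c"], auto)

text \<open>Summation by parts: averaging over neighbours is self-adjoint, so a step of the walk can
  be moved onto the test function. The choices 1 and k^2 give mass and second moment.\<close>

lemma nn_integral_line_walk_Suc:
  fixes f :: "int \<Rightarrow> real"
  assumes "\<And>k. 0 \<le> f k"
  shows "(\<integral>\<^sup>+k. ennreal (line_walk (Suc m) k * f k) \<partial>count_space UNIV) =
    (\<integral>\<^sup>+k. ennreal (line_walk m k * ((f (k + 1) + f (k - 1)) / 2)) \<partial>count_space UNIV)"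
proof -
  have "(\<integral>\<^sup>+k. ennreal (line_walk (Suc m) k * f k) \<partial>count_space UNIV) =
     (\<integral>\<^sup>+k. ennreal (line_walk m (k - 1) * f k / 2) + ennreal (line_walk m (k + 1) * f k / 2) \<partial>count_space UNIV)"
    by (intro nn_integral_cong, subst ennreal_plus[symmetric])
       (auto simp: assms line_walk_nonneg field_simps)
  also have "\<dots> = (\<integral>\<^sup>+k. ennreal (line_walk m (k - 1) * f k / 2) \<partial>count_space UNIV)
     + (\<integral>\<^sup>+k. ennreal (line_walk m (k + 1) * f k / 2) \<partial>count_space UNIV)"
    by (rule nn_integral_add) auto
  also have "\<dots> = (\<integral>\<^sup>+k. ennreal (line_walk m k * f (k + 1) / 2) \<partial>count_space UNIV)
     + (\<integral>\<^sup>+k. ennreal (line_walk m k * f (k - 1) / 2) \<partial>count_space UNIV)"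
    using nn_integral_count_space_int_shift[of "\<lambda>k. ennreal (line_walk m (k - 1) * f k / 2)" 1]
      nn_integral_count_space_int_shift[of "\<lambda>k. ennreal (line_walk m (k + 1) * f k / 2)" "-1"] by simp
  also have "\<dots> = (\<integral>\<^sup>+k. ennreal (line_walk m k * f (k + 1) / 2) + ennreal (line_walk m k * f (k - 1) / 2) \<partial>count_space UNIV)"
    by (rule nn_integral_add[symmetric]) auto
  also have "\<dots> = (\<integral>\<^sup>+k. ennreal (line_walk m k * ((f (k + 1) + f (k - 1)) / 2)) \<partial>count_space UNIV)"
    by (intro nn_integral_cong, subst ennreal_plus[symmetric])
       (auto simp: assms line_walk_nonneg field_simps)
  finally show ?thesis .
qed

lemma nn_integral_line_walk_0:
  fixes f :: "int \<Rightarrow> real"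
  shows "(\<integral>\<^sup>+k. ennreal (line_walk 0 k * f k) \<partial>count_space UNIV) = ennreal (f 0)"
  by (subst nn_integral_count_space'[where A="{0}"]) auto

lemma line_walk_mass: "(\<integral>\<^sup>+k. ennreal (line_walk m k) \<partial>count_space UNIV) = 1"
proof (induction m)
  case 0
  then show ?case using nn_integral_line_walk_0[of "\<lambda>_. 1"] by simp
next
  case (Suc m)
  then show ?case using nn_integral_line_walk_Suc[of "\<lambda>_. 1" m] by simp
qed

text \<open>The neighbour average of k^2 is k^2 + 1, so each step adds one.\<close>

lemma line_walk_second_moment:
  "(\<integral>\<^sup>+k. ennreal (line_walk m k * (real_of_int k)\<^sup>2) \<partial>count_space UNIV) = ennreal (real m)"
proof (induction m)
  case 0
  then show ?case using nn_integral_line_walk_0[of "\<lambda>k. (real_of_int k)\<^sup>2"] by simp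
next
  case (Suc m)
  have "(\<integral>\<^sup>+k. ennreal (line_walk (Suc m) k * (real_of_int k)\<^sup>2) \<partial>count_space UNIV)
    = (\<integral>\<^sup>+k. ennreal (line_walk m k * (((real_of_int (k+1))\<^sup>2 + (real_of_int (k-1))\<^sup>2) / 2)) \<partial>count_space UNIV)"
    by (rule nn_integral_line_walk_Suc) auto
  also have "\<dots> = (\<integral>\<^sup>+k. ennreal (line_walk m k * (real_of_int k)\<^sup>2) + ennreal (line_walk m k) \<partial>count_space UNIV)"
  proof (intro nn_integral_cong)
    fix k :: int
    have "((real_of_int (k+1))\<^sup>2 + (real_of_int (k-1))\<^sup>2) / 2 = (real_of_int k)\<^sup>2 + 1"
      by (simp add: power2_eq_square algebra_simps)
    thus "ennreal (line_walk m k * (((real_of_int (k+1))\<^sup>2 + (real_of_int (k-1))\<^sup>2) / 2))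
      = ennreal (line_walk m k * (real_of_int k)\<^sup>2) + ennreal (line_walk m k)"
      by (simp add: line_walk_nonneg distrib_left flip: ennreal_plus)
  qed
  also have "\<dots> = ennreal (real m) + 1"
    by (subst nn_integral_add) (auto simp: Suc line_walk_mass)
  also have "\<dots> = ennreal (real (Suc m))"
    by (simp add: ennreal_plus[symmetric] add.commute del: ennreal_plus flip: ennreal_1)
  finally show ?case .
qed

section \<open>The lazy walk and its monotonicity\<close>

text \<open>This is 2^m times the law of a walk that rests with probability 1/2 at each step.
  Resting removes the parity obstruction that keeps \<open>line_walk\<close> from being monotone in
  \<bar>k\<bar>.\<close>

definition lazy_line_walk :: "nat \<Rightarrow> int \<Rightarrow> real" where
  "lazy_line_walk m k = (\<Sum>j\<le>m. real (m choose j) * line_walk j k)"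

text \<open>Pascal's rule separates the new step into resting and moving.\<close>

lemma lazy_line_walk_Suc:
  "lazy_line_walk (Suc m) k =
     lazy_line_walk m k + (lazy_line_walk m (k - 1) + lazy_line_walk m (k + 1)) / 2"
proof -
  have "lazy_line_walk (Suc m) k
    = line_walk 0 k + (\<Sum>j\<le>m. real (Suc m choose Suc j) * line_walk (Suc j) k)"
    unfolding lazy_line_walk_def by (subst sum.atMost_Suc_shift) simp
  also have "\<dots> = (line_walk 0 k + (\<Sum>j\<le>m. real (m choose Suc j) * line_walk (Suc j) k))
     + (\<Sum>j\<le>m. real (m choose j) * line_walk (Suc j) k)"
    by (simp add: sum.distrib algebra_simps del: line_walk.simps)
  also have "line_walk 0 k + (\<Sum>j\<le>m. real (m choose Suc j) * line_walk (Suc j) k)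
    = (\<Sum>j\<le>Suc m. real (m choose j) * line_walk j k)"
    by (subst sum.atMost_Suc_shift) (simp del: line_walk.simps)
  \<comment> \<open>The term of index m + 1 is zero because \<open>m choose Suc m\<close>
    vanishes.\<close>
  also have "\<dots> = lazy_line_walk m k"
    unfolding lazy_line_walk_def by simp
  also have "(\<Sum>j\<le>m. real (m choose j) * line_walk (Suc j) k) =
      (lazy_line_walk m (k - 1) + lazy_line_walk m (k + 1)) / 2"
    unfolding lazy_line_walk_def
    by (simp add: sum.distrib[symmetric] sum_divide_distrib algebra_simps)
  finally show ?thesis .
qed

lemma lazy_line_walk_minus: "lazy_line_walk m (- k) = lazy_line_walk m k"
  by (simp add: lazy_line_walk_def line_walk_minus)

text \<open>At the origin the reflection \<open>k \<mapsto> - k\<close> turns the missing inequality into an equality;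
  laziness compensates for it.\<close>
lemma lazy_line_walk_decreasing:
  "0 \<le> k \<Longrightarrow> lazy_line_walk m (k + 1) \<le> lazy_line_walk m k"
proof (induction m arbitrary: k)
  case 0
  then show ?case by (simp add: lazy_line_walk_def)
next
  case (Suc m)
  show ?case
  proof (cases "k = 0")
    case True
    have "lazy_line_walk m (-1) = lazy_line_walk m 1" by (rule lazy_line_walk_minus)
    moreover have "lazy_line_walk m 2 \<le> lazy_line_walk m 1" "lazy_line_walk m 1 \<le> lazy_line_walk m 0"
      using Suc.IH[of 0] Suc.IH[of 1] by simp_all
    ultimately show ?thesis unfolding lazy_line_walk_Suc True by simp
  next
    case False
    hence "lazy_line_walk m (k + 1 + 1) \<le> lazy_line_walk m (k + 1)"
      "lazy_line_walk m (k + 1) \<le> lazy_line_walk m k" "lazy_line_walk m k \<le> lazy_line_walk m (k - 1)"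
      using Suc.IH[of k] Suc.IH[of "k+1"] Suc.IH[of "k-1"] Suc.prems by simp_all
    moreover have "lazy_line_walk m (k + 1 - 1) = lazy_line_walk m k" by simp
    moreover have "b + (a' + c) / 2 \<le> a + (z + b) / 2" if "c \<le> b" "b \<le> a" "a \<le> z" "a' = a"
      for a a' b c z :: real using that by (simp add: field_simps)
    ultimately show ?thesis unfolding lazy_line_walk_Suc by blast
  qed
qed


section \<open>The walk at Poisson times\<close>

definition poisson_weight :: "real \<Rightarrow> nat \<Rightarrow> real" where
  "poisson_weight t m = exp (- t) * t ^ m / fact m"

definition poisson_mean :: "(nat \<Rightarrow> real) \<Rightarrow> real \<Rightarrow> real" where
  "poisson_mean a t = (\<Sum>m. poisson_weight t m * a m)"

lemma poisson_weight_nonneg: "0 \<le> t \<Longrightarrow> 0 \<le> poisson_weight t m"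
  by (simp add: poisson_weight_def)

lemma poisson_weight_sums: "poisson_weight t sums 1"
proof -
  have "(\<lambda>m. exp (- t) * (t ^ m / fact m)) sums (exp (- t) * exp t)"
    using exp_converges[of t] by (intro sums_mult) (simp add: divide_inverse mult.commute)
  thus ?thesis by (simp add: poisson_weight_def[abs_def] exp_minus)
qed

lemma poisson_weight_mean_sums: "(\<lambda>m. poisson_weight t m * real m) sums t"
proof -
  have "(\<lambda>m. t * poisson_weight t m) sums (t * 1)"
    by (intro sums_mult poisson_weight_sums)
  also have "(\<lambda>m. t * poisson_weight t m) = (\<lambda>m. poisson_weight t (Suc m) * real (Suc m))"
    by (auto simp: poisson_weight_def fun_eq_iff divide_simps)
  finally have "(\<lambda>m. poisson_weight t m * real m) sums (t * 1 + poisson_weight t 0 * real 0)"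
    by (rule sums_Suc)
  thus ?thesis by simp
qed

text \<open>The weight at m divided by m + 1 is the weight at m + 1 divided by t, so the sum is the
  probability of a nonzero Poisson value over t.\<close>

lemma poisson_weight_inverse_sums:
  assumes "0 < t"
  shows "(\<lambda>m. poisson_weight t m / (real m + 1)) sums ((1 - exp (- t)) / t)"
proof -
  have "(\<lambda>m. poisson_weight t (Suc m)) sums (1 - poisson_weight t 0)"
    using poisson_weight_sums[of t] by (simp add: sums_Suc_iff)
  hence "(\<lambda>m. poisson_weight t (Suc m) / t) sums ((1 - poisson_weight t 0) / t)"
    by (rule sums_divide)
  also have "(\<lambda>m. poisson_weight t (Suc m) / t) = (\<lambda>m. poisson_weight t m / (real m + 1))"
    using assms by (auto simp: poisson_weight_def fun_eq_iff divide_simps)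
  finally show ?thesis by (simp add: poisson_weight_def)
qed

lemma summable_poisson:
  assumes "0 \<le> t" "\<And>m. 0 \<le> a m" "\<And>m. a m \<le> 1"
  shows "summable (\<lambda>m. poisson_weight t m * a m)"
proof (rule summable_comparison_test')
  show "summable (poisson_weight t)" using poisson_weight_sums by (rule sums_summable)
  show "norm (poisson_weight t m * a m) \<le> poisson_weight t m" for m
    using mult_left_mono[OF assms(3)[of m] poisson_weight_nonneg[OF assms(1), of m]] assms poisson_weight_nonneg[of t m]
    by simp
qed

lemma poisson_mean_nonneg:
  assumes "0 \<le> t" "\<And>m. 0 \<le> a m" "\<And>m. a m \<le> 1"
  shows "0 \<le> poisson_mean a t"
  unfolding poisson_mean_def
  by (intro suminf_nonneg summable_poisson assms mult_nonneg_nonneg poisson_weight_nonneg)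

lemma ennreal_poisson_mean:
  assumes "0 \<le> t" "\<And>m. 0 \<le> a m" "\<And>m. a m \<le> 1"
  shows "ennreal (poisson_mean a t) = (\<Sum>m. ennreal (poisson_weight t m) * ennreal (a m))"
  using suminf_ennreal2[OF _ summable_poisson[OF assms]] poisson_weight_nonneg[OF assms(1)] assms(2)
  by (simp add: poisson_mean_def ennreal_mult)

section \<open>The heat kernel of the one-dimensional walk with jump rate one\<close>

definition line_kernel :: "real \<Rightarrow> int \<Rightarrow> real" where
  "line_kernel s k = poisson_mean (\<lambda>m. line_walk m k) s"

lemma line_kernel_nonneg: "0 \<le> s \<Longrightarrow> 0 \<le> line_kernel s k"
  unfolding line_kernel_def by (intro poisson_mean_nonneg line_walk_nonneg line_walk_le_1)

lemma line_kernel_minus: "line_kernel s (- k) = line_kernel s k"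
  by (simp add: line_kernel_def line_walk_minus)

text \<open>As a function of 1/x, 1/sqrt x lies below its tangent at x = s. Hence the mean of
  1/sqrt(m+1) is controlled by the mean of 1/(m+1), which is explicit.\<close>

lemma line_kernel_origin_le:
  assumes "0 < s"
  shows "line_kernel s 0 \<le> 1 / sqrt s"
proof -
  let ?b = "\<lambda>m. sqrt s / 2 * (poisson_weight s m / (real m + 1)) + 1 / (2 * sqrt s) * poisson_weight s m"
  have b: "?b sums (sqrt s / 2 * ((1 - exp (- s)) / s) + 1 / (2 * sqrt s) * 1)"
    by (intro sums_add sums_mult poisson_weight_sums poisson_weight_inverse_sums assms)
  have amgm: "1 / sqrt x \<le> sqrt s / 2 * (1 / x) + 1 / (2 * sqrt s)" if "0 < x" for x
  proof -
    define u v where "u = sqrt x" and "v = sqrt s"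
    have uv: "0 < u" "0 < v" "x = u * u" using that assms by (auto simp: u_def v_def)
    have "0 \<le> (u - v)\<^sup>2 / (2 * v * u * u)" using uv by simp
    also have "\<dots> = v / 2 * (1 / x) + 1 / (2 * v) - 1 / u"
      using uv by (simp add: power2_eq_square field_simps)
    finally show ?thesis by (simp add: u_def v_def)
  qed
  have "line_kernel s 0 \<le> suminf ?b"
    unfolding line_kernel_def poisson_mean_def
  proof (rule suminf_le)
    show "summable (\<lambda>m. poisson_weight s m * line_walk m 0)"
      using assms by (intro summable_poisson line_walk_nonneg line_walk_le_1) simp
    show "summable ?b" using b by (rule sums_summable)
    fix m
    have "line_walk m 0 \<le> sqrt s / 2 * (1 / (real m + 1)) + 1 / (2 * sqrt s)"
      using line_walk_origin_le[of m] amgm[of "real m + 1"] by simp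
    hence "poisson_weight s m * line_walk m 0
      \<le> poisson_weight s m * (sqrt s / 2 * (1 / (real m + 1)) + 1 / (2 * sqrt s))"
      using assms by (intro mult_left_mono poisson_weight_nonneg) auto
    thus "poisson_weight s m * line_walk m 0 \<le> ?b m" by (simp add: algebra_simps)
  qed
  also have "\<dots> = sqrt s / 2 * ((1 - exp (- s)) / s) + 1 / (2 * sqrt s)"
    using b by (simp add: sums_iff)
  also have "\<dots> \<le> sqrt s / 2 * (1 / s) + 1 / (2 * sqrt s)"
    using assms by (intro add_mono mult_left_mono divide_right_mono) auto
  also have "\<dots> = 1 / sqrt s"
    using assms by (simp add: field_simps)
  finally show ?thesis .
qed

text \<open>A clock of rate two whose ticks are ignored with probability 1/2 is a clock of rate one.
  In terms of series, multiplication by exp s is the binomial transform. Monotonicity thus passes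
  from the lazy walk to the kernel.\<close>

lemma lazy_line_walk_egf:
  assumes "0 \<le> s"
  shows "(\<lambda>m. exp (- 2 * s) * (lazy_line_walk m k * s ^ m / fact m)) sums line_kernel s k"
proof -
  let ?a = "\<lambda>m. s ^ m / fact m" and ?b = "\<lambda>m. line_walk m k * s ^ m / fact m"
  have sa: "summable (\<lambda>m. norm (?a m))"
    using summable_norm_exp[of s] by (simp add: divide_inverse mult.commute)
  have sb: "summable (\<lambda>m. norm (?b m))"
  proof (rule summable_comparison_test'[OF sa])
    show "norm (norm (?b m)) \<le> norm (?a m)" for m
      using mult_right_mono[OF line_walk_le_1[of m k], of "s ^ m"] assms
      by (simp add: line_walk_nonneg divide_right_mono)
  qed
  have a: "(\<Sum>m. ?a m) = exp s"
    by (simp add: exp_def divide_inverse mult.commute)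
  have b: "exp (- s) * (\<Sum>m. ?b m) = line_kernel s k"
    unfolding line_kernel_def poisson_mean_def poisson_weight_def
    by (subst suminf_mult[symmetric, OF summable_norm_cancel[OF sb]]) (simp add: mult_ac)
  have "(\<lambda>m. \<Sum>i\<le>m. ?a i * ?b (m - i)) sums ((\<Sum>m. ?a m) * (\<Sum>m. ?b m))"
    by (rule Cauchy_product_sums[OF sa sb])
  also have "(\<lambda>m. \<Sum>i\<le>m. ?a i * ?b (m - i)) = (\<lambda>m. lazy_line_walk m k * s ^ m / fact m)"
  proof
    fix m
    have "(\<Sum>i\<le>m. ?a i * ?b (m - i)) = (\<Sum>j\<le>m. ?a (m - j) * ?b j)"
      by (rule sum.reindex_bij_witness[of _ "\<lambda>j. m - j" "\<lambda>j. m - j"]) auto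
    also have "\<dots> = (\<Sum>j\<le>m. real (m choose j) * line_walk j k * s ^ m / fact m)"
    proof (rule sum.cong)
      fix j assume j: "j \<in> {..m}"
      hence "s ^ m = s ^ (m - j) * s ^ j" by (simp flip: power_add)
      with j show "?a (m - j) * ?b j = real (m choose j) * line_walk j k * s ^ m / fact m"
        by (simp add: binomial_fact mult_ac)
    qed simp
    also have "\<dots> = lazy_line_walk m k * s ^ m / fact m"
      by (simp add: lazy_line_walk_def sum_distrib_right sum_divide_distrib)
    finally show "(\<Sum>i\<le>m. ?a i * ?b (m - i)) = lazy_line_walk m k * s ^ m / fact m" .
  qed
  finally have "(\<lambda>m. exp (- 2 * s) * (lazy_line_walk m k * s ^ m / fact m)) sums
      (exp (- 2 * s) * (exp s * (\<Sum>m. ?b m)))"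
    unfolding a by (rule sums_mult)
  also have "exp (- 2 * s) * (exp s * (\<Sum>m. ?b m)) = exp (- s) * (\<Sum>m. ?b m)"
    by (simp flip: mult.assoc exp_add)
  finally show ?thesis by (simp only: b)
qed

lemma line_kernel_decreasing_Suc:
  assumes "0 \<le> s" "0 \<le> k"
  shows "line_kernel s (k + 1) \<le> line_kernel s k"
proof (rule sums_le)
  show "(\<lambda>m. exp (- 2 * s) * (lazy_line_walk m (k + 1) * s ^ m / fact m)) sums line_kernel s (k + 1)"
    "(\<lambda>m. exp (- 2 * s) * (lazy_line_walk m k * s ^ m / fact m)) sums line_kernel s k"
    by (rule lazy_line_walk_egf[OF assms(1)])+
  show "exp (- 2 * s) * (lazy_line_walk m (k + 1) * s ^ m / fact m)
      \<le> exp (- 2 * s) * (lazy_line_walk m k * s ^ m / fact m)" for m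
    using assms lazy_line_walk_decreasing[OF assms(2), of m]
    by (intro mult_left_mono divide_right_mono mult_right_mono) auto
qed

lemma line_kernel_decreasing:
  assumes "0 \<le> s" "\<bar>j\<bar> \<le> \<bar>k\<bar>"
  shows "line_kernel s k \<le> line_kernel s j"
proof -
  have abs: "line_kernel s \<bar>i\<bar> = line_kernel s i" for i
    using line_kernel_minus[of s i] by (cases "i < 0") simp_all
  have "line_kernel s (\<bar>j\<bar> + int n) \<le> line_kernel s \<bar>j\<bar>" for n
  proof (induction n)
    case (Suc n)
    have "line_kernel s (\<bar>j\<bar> + int n + 1) \<le> line_kernel s (\<bar>j\<bar> + int n)"
      by (rule line_kernel_decreasing_Suc[OF assms(1)]) simp
    moreover have "\<bar>j\<bar> + int n + 1 = \<bar>j\<bar> + int (Suc n)" by simp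
    ultimately show ?case using Suc by simp
  qed simp
  from this[of "nat (\<bar>k\<bar> - \<bar>j\<bar>)"] assms(2) have "line_kernel s \<bar>k\<bar> \<le> line_kernel s \<bar>j\<bar>" by simp
  thus ?thesis by (simp only: abs)
qed

text \<open>Tonelli: an expectation known for each fixed number of steps is averaged with the
  Poisson weights.\<close>

lemma nn_integral_line_kernel:
  fixes f :: "int \<Rightarrow> real"
  assumes "0 \<le> s" "\<And>k. 0 \<le> f k"
    and "\<And>m. (\<integral>\<^sup>+k. ennreal (line_walk m k * f k) \<partial>count_space UNIV) = ennreal (c m)"
    and "\<And>m. 0 \<le> c m" and "(\<lambda>m. poisson_weight s m * c m) sums C"
  shows "(\<integral>\<^sup>+k. ennreal (line_kernel s k * f k) \<partial>count_space UNIV) = ennreal C"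
proof -
  have "(\<integral>\<^sup>+k. ennreal (line_kernel s k * f k) \<partial>count_space UNIV)
     = (\<integral>\<^sup>+k. (\<Sum>m. ennreal (poisson_weight s m) * ennreal (line_walk m k * f k)) \<partial>count_space UNIV)"
  proof (rule nn_integral_cong)
    fix k
    have "ennreal (line_kernel s k * f k) = ennreal (line_kernel s k) * ennreal (f k)"
      using assms(1,2) by (simp add: ennreal_mult line_kernel_nonneg)
    also have "\<dots> = (\<Sum>m. ennreal (poisson_weight s m) * ennreal (line_walk m k)) * ennreal (f k)"
      unfolding line_kernel_def
      by (subst ennreal_poisson_mean) (auto simp: assms line_walk_nonneg line_walk_le_1)
    also have "\<dots> = (\<Sum>m. ennreal (poisson_weight s m) * ennreal (line_walk m k * f k))"
      by (simp add: ennreal_mult line_walk_nonneg assms(2) mult.assoc flip: ennreal_suminf_multc)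
    finally show "ennreal (line_kernel s k * f k) =
      (\<Sum>m. ennreal (poisson_weight s m) * ennreal (line_walk m k * f k))" .
  qed
  also have "\<dots> = (\<Sum>m. \<integral>\<^sup>+k. ennreal (poisson_weight s m) * ennreal (line_walk m k * f k) \<partial>count_space UNIV)"
    by (rule nn_integral_suminf) auto
  also have "\<dots> = (\<Sum>m. ennreal (poisson_weight s m * c m))"
    using assms by (subst nn_integral_cmult) (auto simp: ennreal_mult poisson_weight_nonneg)
  also have "\<dots> = ennreal C"
    using assms by (subst suminf_ennreal_eq) (auto simp: poisson_weight_nonneg)
  finally show ?thesis .
qed

lemma line_kernel_mass:
  assumes "0 \<le> s"
  shows "(\<integral>\<^sup>+k. ennreal (line_kernel s k) \<partial>count_space UNIV) = 1"
  using nn_integral_line_kernel[of s "\<lambda>_. 1" "\<lambda>_. 1" 1] assms poisson_weight_sums[of s]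
  by (simp add: line_walk_mass)

lemma line_kernel_second_moment:
  assumes "0 \<le> s"
  shows "(\<integral>\<^sup>+k. ennreal (line_kernel s k * (real_of_int k)\<^sup>2) \<partial>count_space UNIV) = ennreal s"
  using nn_integral_line_kernel[of s "\<lambda>k. (real_of_int k)\<^sup>2" real s] assms poisson_weight_mean_sums[of s]
  by (simp add: line_walk_second_moment)

lemma line_kernel_le_1:
  assumes "0 \<le> s"
  shows "line_kernel s k \<le> 1"
proof -
  have "ennreal (line_kernel s k) \<le> (\<integral>\<^sup>+k. ennreal (line_kernel s k) \<partial>count_space UNIV)"
    using nn_integral_ge_point[of k UNIV "\<lambda>k. ennreal (line_kernel s k)"] by simp
  thus ?thesis by (simp add: line_kernel_mass assms)
qed

text \<open>Chebyshev confines mass \<open>3/4\<close> to \<open>[-B, B]\<close>, and the bound on the diagonal leaves at most mass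
  \<open>1/2\<close> for \<open>[-A, A]\<close>; by monotonicity the remaining values are at most the one at \<open>A\<close>.\<close>
lemma line_kernel_lower_bound:
  assumes "1 \<le> A" "8 * real A \<le> sqrt s" "\<bar>k\<bar> \<le> int A"
  shows "1 / (28 * sqrt s) \<le> line_kernel s k"
proof -
  \<comment> \<open>About twice the standard deviation, so that Chebyshev leaves at most 1/4 outside
    [-B, B].\<close>
  define B where "B = nat \<lceil>2 * sqrt s\<rceil>"
  have sq: "8 \<le> sqrt s" using assms by linarith
  have s: "0 < s" using sq by (smt (verit) real_sqrt_le_0_iff)
  have B: "2 * sqrt s \<le> real B" "real B \<le> 2 * sqrt s + 1" using sq unfolding B_def by linarith+
  have Bpos: "0 < real B" using B sq by linarith
  let ?g = "line_kernel s"
  have g: "0 \<le> ?g j" for j using s by (simp add: line_kernel_nonneg)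
  have card: "(\<integral>\<^sup>+j. indicator {- int n..int n} j \<partial>count_space UNIV) = ennreal (2 * real n + 1)" for n
    by (subst nn_integral_indicator) (auto simp: emeasure_count_space ennreal_of_nat_eq_real_of_nat)
  have "1 = (\<integral>\<^sup>+j. ennreal (?g j) \<partial>count_space UNIV)" using s by (simp add: line_kernel_mass)
  \<comment> \<open>The three terms dominate the kernel on |j| \<le> A, on A < |j| \<le> B and on
    |j| > B respectively.\<close>
  also have "\<dots> \<le> (\<integral>\<^sup>+j. ennreal (?g 0) * indicator {- int A..int A} j +
        (ennreal (?g (int A)) * indicator {- int B..int B} j
         + ennreal (1 / (real B)\<^sup>2) * ennreal (?g j * (real_of_int j)\<^sup>2)) \<partial>count_space UNIV)"
  proof (rule nn_integral_mono)
    fix j :: int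
    consider "\<bar>j\<bar> \<le> int A" | "int A < \<bar>j\<bar>" "\<bar>j\<bar> \<le> int B" | "int B < \<bar>j\<bar>" by linarith
    thus "ennreal (?g j) \<le> ennreal (?g 0) * indicator {- int A..int A} j +
        (ennreal (?g (int A)) * indicator {- int B..int B} j
         + ennreal (1 / (real B)\<^sup>2) * ennreal (?g j * (real_of_int j)\<^sup>2))"
    proof cases
      case 1
      have "ennreal (?g j) \<le> ennreal (?g 0) * indicator {- int A..int A} j"
        using 1 s line_kernel_decreasing[of s 0 j] by (auto simp: indicator_def ennreal_leI)
      thus ?thesis by (rule add_increasing2[rotated]) simp
    next
      case 2
      have "ennreal (?g j) \<le> ennreal (?g (int A)) * indicator {- int B..int B} j"
        using 2 s line_kernel_decreasing[of s "int A" j] by (auto simp: indicator_def ennreal_leI)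
      thus ?thesis by (intro add_increasing add_increasing2) auto
    next
      case 3
      have "real B \<le> \<bar>real_of_int j\<bar>" using 3 by linarith
      hence "(real B)\<^sup>2 \<le> (real_of_int j)\<^sup>2" by (metis abs_of_nat abs_le_square_iff)
      hence "1 \<le> (real_of_int j)\<^sup>2 / (real B)\<^sup>2" using Bpos by simp
      hence "?g j * 1 \<le> ?g j * ((real_of_int j)\<^sup>2 / (real B)\<^sup>2)" using g by (intro mult_left_mono)
      hence "ennreal (?g j) \<le> ennreal (1 / (real B)\<^sup>2) * ennreal (?g j * (real_of_int j)\<^sup>2)"
        using g by (simp add: ennreal_mult[symmetric] ennreal_leI mult.commute)
      thus ?thesis by (intro add_increasing) auto
    qed
  qed
  also have "\<dots> = ennreal (?g 0) * ennreal (2 * real A + 1) +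
       (ennreal (?g (int A)) * ennreal (2 * real B + 1) + ennreal (1 / (real B)\<^sup>2) * ennreal s)"
    using s by (simp add: nn_integral_add nn_integral_cmult card line_kernel_second_moment)
  also have "\<dots> = ennreal (?g 0 * (2 * real A + 1) + (?g (int A) * (2 * real B + 1) + s / (real B)\<^sup>2))"
    using g s by (simp add: ennreal_mult[symmetric] flip: ennreal_plus)
  finally have *: "1 \<le> ?g 0 * (2 * real A + 1) + (?g (int A) * (2 * real B + 1) + s / (real B)\<^sup>2)"
    by (simp only: ennreal_ge_1)
  have "?g 0 * (2 * real A + 1) \<le> 1 / sqrt s * (2 * real A + 1)"
    by (intro mult_right_mono line_kernel_origin_le s) auto
  \<comment> \<open>8A \<le> sqrt s bounds 2A by the first summand, and with A \<ge> 1 it gives sqrt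
    s \<ge> 8, so that the second absorbs the 1.\<close>
  also have "\<dots> \<le> 1 / sqrt s * (sqrt s / 4 + sqrt s / 8)"
    using assms sq s by (intro mult_left_mono) auto
  also have "\<dots> = 3 / 8" using sq s by (simp add: field_simps)
  finally have 1: "?g 0 * (2 * real A + 1) \<le> 3 / 8" .
  have "(2 * sqrt s)\<^sup>2 \<le> (real B)\<^sup>2" using B sq s by (intro power_mono) auto
  hence "4 * s \<le> (real B)\<^sup>2" using s by (simp add: power_mult_distrib)
  hence 2: "s / (real B)\<^sup>2 \<le> 1 / 4" using Bpos by (simp add: field_simps)
  \<comment> \<open>2B + 1 \<le> 4 sqrt s + 3 \<le> 7 sqrt s. The remaining mass is at least 1 - 3/8
    - 1/4 \<ge> 1/4, whence 28 = 4 * 7.\<close>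
  have "?g (int A) * (2 * real B + 1) \<le> ?g (int A) * (7 * sqrt s)"
    using B sq s g by (intro mult_left_mono) auto
  hence "1 / 4 \<le> ?g (int A) * (7 * sqrt s)" using * 1 2 by linarith
  hence "1 / (28 * sqrt s) \<le> ?g (int A)" using sq s by (simp add: field_simps)
  also have "\<dots> \<le> ?g k" using assms s by (intro line_kernel_decreasing) auto
  finally show ?thesis .
qed


section \<open>The Green function of the walk on the lattice\<close>

fun srw_power :: "nat \<Rightarrow> int ^ 'd::finite \<Rightarrow> real" where
  "srw_power 0 z = of_bool (z = 0)"
| "srw_power (Suc m) z =
     (\<Sum>i\<in>UNIV. srw_power m (z + axis i 1) + srw_power m (z - axis i 1)) / (2 * real CARD('d))"

lemma srw_power_nonneg: "0 \<le> srw_power m z"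
  by (induction m arbitrary: z) (auto intro!: divide_nonneg_nonneg sum_nonneg add_nonneg_nonneg)

lemma srw_power_le_1: "srw_power m (z :: int ^ 'd::finite) \<le> 1"
proof (induction m arbitrary: z)
  case (Suc m)
  have "(\<Sum>i\<in>(UNIV::'d set). srw_power m (z + axis i 1) + srw_power m (z - axis i 1)) \<le> (\<Sum>i\<in>(UNIV::'d set). 1 + 1)"
    by (intro sum_mono add_mono Suc.IH)
  thus ?case by simp
qed auto

section \<open>Independence of the coordinates through generating functions\<close>

text \<open>A given coordinate moves with probability 1/d at each step, so in continuous time it is
  slowed down by the factor d; \<open>d ^ m\<close> accounts for this.\<close>

definition line_egf :: "real \<Rightarrow> int \<Rightarrow> real fps" where
  "line_egf d k = Abs_fps (\<lambda>m. line_walk m k / (d ^ m * fact m))"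

lemma fps_deriv_line_egf:
  "d \<noteq> 0 \<Longrightarrow> fps_deriv (line_egf d k) = fps_const (1 / (2 * d)) * (line_egf d (k - 1) + line_egf d (k + 1))"
proof (rule fps_ext)
  fix m assume "d \<noteq> 0"
  have "fps_nth (fps_deriv (line_egf d k)) m
      = real (Suc m) * (line_walk (Suc m) k / (d ^ Suc m * (real (Suc m) * fact m)))"
    by (simp add: line_egf_def del: of_nat_Suc line_walk.simps)
  also have "\<dots> = line_walk (Suc m) k / (d * (d ^ m * fact m))"
    by (simp add: mult.assoc del: of_nat_Suc line_walk.simps)
  also have "\<dots> = fps_nth (fps_const (1 / (2 * d)) * (line_egf d (k - 1) + line_egf d (k + 1))) m"
    using \<open>d \<noteq> 0\<close> by (simp add: line_egf_def field_simps)
  finally show "fps_nth (fps_deriv (line_egf d k)) m =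
      fps_nth (fps_const (1 / (2 * d)) * (line_egf d (k - 1) + line_egf d (k + 1))) m" .
qed

lemma fps_deriv_prod:
  fixes f :: "'b \<Rightarrow> 'a::comm_ring_1 fps"
  assumes "finite I"
  shows "fps_deriv (\<Prod>i\<in>I. f i) = (\<Sum>i\<in>I. fps_deriv (f i) * (\<Prod>j\<in>I - {i}. f j))"
  using assms
proof (induction I)
  case (insert x I)
  have "(\<Prod>j\<in>insert x I - {i}. f j) = f x * (\<Prod>j\<in>I - {i}. f j)" if "i \<in> I" for i
  proof -
    have "insert x I - {i} = insert x (I - {i})" using insert that by auto
    thus ?thesis using insert by simp
  qed
  moreover have "insert x I - {x} = I" using insert by auto
  ultimately show ?case using insert
    by (simp add: sum_distrib_left algebra_simps cong: sum.cong)
qed simp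

text \<open>By the product rule, differentiation shifts one coordinate at a time by one, with weight
  1/(2d). On coefficients this is the recursion of \<open>srw_power\<close>.\<close>

lemma prod_line_egf_nth:
  fixes z :: "int ^ 'd::finite"
  shows "fps_nth (\<Prod>i\<in>UNIV. line_egf (real CARD('d)) (z $ i)) m = srw_power m z / fact m"
proof (induction m arbitrary: z)
  case 0
  have "(\<Prod>i\<in>UNIV. fps_nth (line_egf (real CARD('d)) (z $ i)) 0) = (of_bool (z = 0) :: real)"
    by (auto simp: line_egf_def vec_eq_iff prod_zero_iff)
  thus ?case by (simp add: fps_prod_nth')
next
  case (Suc m)
  let ?d = "real CARD('d)"
  let ?F = "\<lambda>z::int^'d. \<Prod>i\<in>UNIV. line_egf ?d (z $ i)"
  have shift: "line_egf ?d (z $ i + c) * (\<Prod>j\<in>UNIV - {i}. line_egf ?d (z $ j)) = ?F (z + axis i c)" for i c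
  proof -
    have "?F (z + axis i c) = line_egf ?d ((z + axis i c) $ i) * (\<Prod>j\<in>UNIV - {i}. line_egf ?d ((z + axis i c) $ j))"
      by (rule prod.remove) auto
    also have "(\<Prod>j\<in>UNIV - {i}. line_egf ?d ((z + axis i c) $ j)) = (\<Prod>j\<in>UNIV - {i}. line_egf ?d (z $ j))"
      by (rule prod.cong) (auto simp: axis_def)
    finally show ?thesis by (simp add: axis_def)
  qed
  have "real (Suc m) * fps_nth (?F z) (Suc m) = fps_nth (fps_deriv (?F z)) m"
    by simp
  also have "fps_deriv (?F z) = (\<Sum>i\<in>UNIV. fps_const (1 / (2 * ?d)) * (?F (z + axis i 1) + ?F (z + axis i (-1))))"
  proof -
    have "fps_deriv (line_egf ?d (z $ i)) * (\<Prod>j\<in>UNIV - {i}. line_egf ?d (z $ j))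
      = fps_const (1 / (2 * ?d)) * (?F (z + axis i 1) + ?F (z + axis i (-1)))" for i
    proof -
      have d: "?d \<noteq> 0" by simp
      have "fps_deriv (line_egf ?d (z $ i)) * (\<Prod>j\<in>UNIV - {i}. line_egf ?d (z $ j))
        = fps_const (1 / (2 * ?d)) * (line_egf ?d (z $ i + 1) * (\<Prod>j\<in>UNIV - {i}. line_egf ?d (z $ j))
           + line_egf ?d (z $ i + (-1)) * (\<Prod>j\<in>UNIV - {i}. line_egf ?d (z $ j)))"
        unfolding fps_deriv_line_egf[OF d] by (simp add: algebra_simps)
      thus ?thesis unfolding shift .
    qed
    thus ?thesis by (simp add: fps_deriv_prod)
  qed
  also have "fps_nth \<dots> m = (\<Sum>i\<in>UNIV. 1 / (2 * ?d) * (srw_power m (z + axis i 1) / fact m + srw_power m (z + axis i (-1)) / fact m))"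
    by (simp only: fps_sum_nth fps_mult_left_const_nth fps_add_nth Suc.IH)
  also have "\<dots> = srw_power (Suc m) z / fact m"
  proof -
    have "srw_power m (z + axis i (-1)) = srw_power m (z - axis i 1)" for i
      by (rule arg_cong[where f="srw_power m"]) (simp add: vec_eq_iff axis_def)
    thus ?thesis by (simp add: sum_divide_distrib add_divide_distrib mult.commute del: minus_add_distrib)
  qed
  finally show ?case by (simp add: field_simps del: srw_power.simps of_nat_Suc)
qed

text \<open>Convergence everywhere is carried along in the induction, since evaluating a product
  requires it of both factors.\<close>

lemma eval_fps_prod:
  fixes f :: "'b \<Rightarrow> real fps"
  assumes "finite I" "\<And>i. i \<in> I \<Longrightarrow> fps_conv_radius (f i) = \<infinity>"
  shows "fps_conv_radius (\<Prod>i\<in>I. f i) = \<infinity> \<and> eval_fps (\<Prod>i\<in>I. f i) t = (\<Prod>i\<in>I. eval_fps (f i) t)"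
  using assms
proof (induction I)
  case (insert x I)
  have "fps_conv_radius (f x * (\<Prod>i\<in>I. f i)) = \<infinity>"
    using fps_conv_radius_mult[of "f x" "\<Prod>i\<in>I. f i"] insert by simp
  thus ?case using insert by (simp add: eval_fps_mult)
qed auto

definition srw_kernel :: "real \<Rightarrow> int ^ 'd::finite \<Rightarrow> real" where
  "srw_kernel t z = poisson_mean (\<lambda>m. srw_power m z) t"

text \<open>The walk run at the times of a Poisson process has independent coordinates.\<close>
lemma srw_kernel_product:
  fixes z :: "int ^ 'd::finite"
  shows "srw_kernel t z = (\<Prod>i\<in>UNIV. line_kernel (t / real CARD('d)) (z $ i))"
proof -
  let ?d = "real CARD('d)"
  let ?f = "\<lambda>i. line_egf ?d (z $ i)"
  have rad: "fps_conv_radius (?f i) = \<infinity>" for i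
    unfolding fps_conv_radius_def
  proof (rule conv_radius_inftyI'')
    fix x :: real
    have "summable (\<lambda>m. norm ((x / ?d) ^ m / fact m))"
      using summable_norm_exp[of "x / ?d"] by (simp add: divide_inverse mult.commute)
    thus "summable (\<lambda>m. fps_nth (?f i) m * x ^ m)"
    proof (rule summable_comparison_test')
      fix m
      have "norm (fps_nth (?f i) m * x ^ m) = line_walk m (z $ i) * norm ((x / ?d) ^ m / fact m)"
        by (simp add: line_egf_def abs_mult power_divide line_walk_nonneg)
      also have "\<dots> \<le> 1 * norm ((x / ?d) ^ m / fact m)"
        by (intro mult_right_mono line_walk_le_1) simp
      finally show "norm (fps_nth (?f i) m * x ^ m) \<le> norm ((x / ?d) ^ m / fact m)" by simp
    qed
  qed
  have ev: "exp (- t) * eval_fps (\<Prod>i\<in>UNIV. ?f i) t = srw_kernel t z"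
  proof -
    have "summable (\<lambda>m. fps_nth (\<Prod>i\<in>UNIV. ?f i) m * t ^ m)"
      by (rule summable_fps) (simp add: eval_fps_prod rad)
    thus ?thesis
      unfolding eval_fps_def srw_kernel_def poisson_mean_def poisson_weight_def
      by (subst suminf_mult[symmetric]) (auto simp: prod_line_egf_nth algebra_simps)
  qed
  have ev1: "exp (- (t / ?d)) * eval_fps (?f i) t = line_kernel (t / ?d) (z $ i)" for i
  proof -
    have "summable (\<lambda>m. fps_nth (?f i) m * t ^ m)" by (rule summable_fps) (simp add: rad)
    thus ?thesis
      unfolding eval_fps_def line_kernel_def poisson_mean_def poisson_weight_def
      by (subst suminf_mult[symmetric]) (auto simp: line_egf_def power_divide algebra_simps)
  qed
  \<comment> \<open>The prefactor splits evenly, leaving each coordinate with the Poisson weights of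
    mean t/d.\<close>
  have "exp (- t) = (\<Prod>i\<in>(UNIV::'d set). exp (- (t / ?d)))"
    by (simp flip: exp_of_nat_mult)
  hence "srw_kernel t z = (\<Prod>i\<in>UNIV. exp (- (t / ?d)) * eval_fps (?f i) t)"
    unfolding ev[symmetric] prod.distrib by (simp add: eval_fps_prod rad)
  thus ?thesis by (simp only: ev1)
qed

section \<open>Bounds for the Green function\<close>

text \<open>Values in \<open>ennreal\<close> let sums be rearranged before finiteness is
  known.\<close>

definition green :: "int ^ 'd::finite \<Rightarrow> ennreal" where
  "green z = (\<Sum>m. ennreal (srw_power m z))"

lemma ennreal_srw_kernel:
  "0 \<le> t \<Longrightarrow> ennreal (srw_kernel t z) = (\<Sum>m. ennreal (poisson_weight t m) * ennreal (srw_power m z))"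
  unfolding srw_kernel_def
  by (intro ennreal_poisson_mean srw_power_nonneg srw_power_le_1)

text \<open>In the variable t the weight is the Erlang density of the (m+1)-st jump time.\<close>

lemma nn_integral_poisson_weight:
  "(\<integral>\<^sup>+t. ennreal (poisson_weight t m) * indicator {0..} t \<partial>lborel) = 1"
proof -
  have "(\<integral>\<^sup>+t. ennreal (poisson_weight t m) * indicator {0..} t \<partial>lborel)
      = (\<integral>\<^sup>+t. ennreal (erlang_density m 1 t * t ^ 0) \<partial>lborel)"
    by (intro nn_integral_cong) (auto simp: erlang_density_def poisson_weight_def indicator_def mult.commute)
  also have "\<dots> = 1" by (subst nn_integral_erlang_ith_moment) auto
  finally show ?thesis .
qed

text \<open>The continuous-time walk waits for mean time one between jumps, so integration over time
  counts every step once.\<close>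

lemma green_eq_integral:
  "green z = (\<integral>\<^sup>+t. ennreal (srw_kernel t z) * indicator {0..} t \<partial>lborel)"
proof -
  have "(\<integral>\<^sup>+t. ennreal (srw_kernel t z) * indicator {0..} t \<partial>lborel) =
      (\<integral>\<^sup>+t. (\<Sum>m. ennreal (srw_power m z) * (ennreal (poisson_weight t m) * indicator {0..} t)) \<partial>lborel)"
    by (intro nn_integral_cong) (auto simp: ennreal_srw_kernel indicator_def mult.commute)
  also have "\<dots> = (\<Sum>m. \<integral>\<^sup>+t. ennreal (srw_power m z) * (ennreal (poisson_weight t m) * indicator {0..} t) \<partial>lborel)"
    by (rule nn_integral_suminf) (auto simp: poisson_weight_def)
  also have "\<dots> = green z"
    by (subst nn_integral_cmult) (auto simp: poisson_weight_def[abs_def] nn_integral_poisson_weight[unfolded poisson_weight_def] green_def)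
  finally show ?thesis by simp
qed

text \<open>Up to time one the kernel is at most 1. Later it is a product of factors in [0, 1], of
  which three already give order t^(-3/2), integrable at infinity.\<close>

lemma green_origin_finite:
  assumes "3 \<le> CARD('d::finite)"
  shows "green (0 :: int ^ 'd) < \<infinity>"
proof -
  let ?d = "real CARD('d)"
  \<comment> \<open>\<open>?F\<close> is an antiderivative of \<open>?f\<close> that vanishes at
    infinity.\<close>
  let ?F = "\<lambda>t. - 2 * (?d * sqrt ?d) / sqrt t" and ?f = "\<lambda>t. ?d * sqrt ?d / (t * sqrt t)"
  have kernel: "srw_kernel t (0 :: int ^ 'd) = line_kernel (t / ?d) 0 ^ CARD('d)" for t
    by (simp add: srw_kernel_product)
  have "green (0 :: int ^ 'd) \<le>
    (\<integral>\<^sup>+t. indicator {0..1} t + ennreal (?f t) * indicator {1..} t \<partial>lborel)"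
    unfolding green_eq_integral
  proof (rule nn_integral_mono)
    fix t :: real
    consider "t < 0" | "0 \<le> t" "t \<le> 1" | "1 < t" by linarith
    thus "ennreal (srw_kernel t (0 :: int ^ 'd)) * indicator {0..} t
        \<le> indicator {0..1} t + ennreal (?f t) * indicator {1..} t"
    proof cases
      case 2
      have "ennreal (srw_kernel t (0 :: int ^ 'd)) \<le> 1"
        unfolding kernel using 2 by (simp only: ennreal_le_1) (auto intro!: power_le_one line_kernel_nonneg line_kernel_le_1)
      thus ?thesis using 2 by (auto simp: indicator_def intro: order_trans add_increasing2)
    next
      case 3
      have "line_kernel (t / ?d) 0 ^ CARD('d) \<le> line_kernel (t / ?d) 0 ^ 3"
        using 3 assms by (intro power_decreasing line_kernel_nonneg line_kernel_le_1) auto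
      also have "\<dots> \<le> (1 / sqrt (t / ?d)) ^ 3"
        using 3 by (intro power_mono line_kernel_nonneg line_kernel_origin_le) auto
      also have "\<dots> = ?f t"
        using 3 by (simp add: real_sqrt_divide power3_eq_cube)
      finally show ?thesis using 3 by (simp add: kernel ennreal_leI)
    qed auto
  qed
  also have "\<dots> = 1 + (\<integral>\<^sup>+t. ennreal (?f t) * indicator {1..} t \<partial>lborel)"
    by (subst nn_integral_add) auto
  also have "(\<integral>\<^sup>+t. ennreal (?f t) * indicator {1..} t \<partial>lborel) = ennreal (0 - ?F 1)"
  proof (rule nn_integral_FTC_atLeast)
    fix t :: real assume t: "1 \<le> t"
    show "DERIV ?F t :> ?f t"
      using t by (auto intro!: derivative_eq_intros simp: divide_simps)
    show "0 \<le> ?f t" using t by simp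
  next
    show "(?F \<longlongrightarrow> 0) at_top"
      by (intro tendsto_divide_0[OF tendsto_const] filterlim_at_top_imp_at_infinity sqrt_at_top)
  qed simp
  also have "1 + ennreal (0 - ?F 1) < \<infinity>" by simp
  finally show ?thesis .
qed

lemma srw_kernel_lower_bound:
  fixes z :: "int ^ 'd::finite"
  assumes "1 \<le> n" "\<And>i. \<bar>z $ i\<bar> \<le> 2 * int n"
    and t: "256 * real CARD('d) * (real n)\<^sup>2 \<le> t" "t \<le> 512 * real CARD('d) * (real n)\<^sup>2"
  shows "(1 / (644 * real n)) ^ CARD('d) \<le> srw_kernel t z"
proof -
  let ?s = "t / real CARD('d)"
  have "256 * (real n)\<^sup>2 \<le> ?s" "?s \<le> 512 * (real n)\<^sup>2"
    using t by (simp_all add: field_simps)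
  \<comment> \<open>16n = 8 * 2n is what \<open>line_kernel_lower_bound\<close> asks for with 2n in
    place of A. The 23 comes from 23^2 = 529 \<ge> 512, and 28 * 23 = 644.\<close>
  hence "(16 * real n)\<^sup>2 \<le> ?s" "?s \<le> (23 * real n)\<^sup>2"
    by (simp_all add: power_mult_distrib)
  hence s: "16 * real n \<le> sqrt ?s" "sqrt ?s \<le> 23 * real n"
    by (auto intro: real_le_rsqrt real_le_lsqrt)
  hence "0 < sqrt ?s" using assms(1) by (auto intro: less_le_trans[of 0 "16 * real n"] simp del: real_sqrt_gt_0_iff)
  hence pos: "0 < t" by (simp add: zero_less_divide_iff)
  have "1 / (644 * real n) \<le> line_kernel ?s (z $ i)" for i
  proof -
    have "1 / (644 * real n) \<le> 1 / (28 * sqrt ?s)"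
      using s assms(1) by (intro divide_left_mono mult_pos_pos) (use pos in auto)
    also have "\<dots> \<le> line_kernel ?s (z $ i)"
      using s assms(1) assms(2)[of i] by (intro line_kernel_lower_bound[of "2 * n"]) auto
    finally show ?thesis .
  qed
  hence "(\<Prod>i\<in>(UNIV::'d set). 1 / (644 * real n)) \<le> (\<Prod>i\<in>UNIV. line_kernel ?s (z $ i))"
    by (intro prod_mono) auto
  thus ?thesis by (simp add: srw_kernel_product)
qed

text \<open>The time window [T, 2T] with T = 256 d n^2 alone contributes its length times the kernel
  bound, which is of order n^(2-d).\<close>

lemma green_lower_bound:
  fixes z :: "int ^ 'd::finite"
  assumes "1 \<le> n" "\<And>i. \<bar>z $ i\<bar> \<le> 2 * int n"
  shows "ennreal (256 * real CARD('d) * (real n)\<^sup>2 * (1 / (644 * real n)) ^ CARD('d)) \<le> green z"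
proof -
  let ?T = "256 * real CARD('d) * (real n)\<^sup>2" and ?c = "(1 / (644 * real n)) ^ CARD('d)"
  have "ennreal (?T * ?c) = (\<integral>\<^sup>+t. ennreal ?c * indicator {?T..2 * ?T} t \<partial>lborel)"
    by (subst nn_integral_cmult_indicator) (auto simp: ennreal_mult mult_ac)
  also have "\<dots> \<le> green z"
    unfolding green_eq_integral
  proof (rule nn_integral_mono)
    fix t :: real
    show "ennreal ?c * indicator {?T..2 * ?T} t \<le> ennreal (srw_kernel t z) * indicator {0..} t"
    proof (cases "t \<in> {?T..2 * ?T}")
      case True
      hence "0 \<le> t" by (auto elim!: order_trans[rotated])
      with True show ?thesis
        using srw_kernel_lower_bound[OF assms, of t] by (auto intro: ennreal_leI)
    qed simp
  qed
  finally show ?thesis by simp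
qed


section \<open>Path sums\<close>

lemma nn_integral_count_space_inj_le:
  assumes "inj_on g S"
  shows "(\<integral>\<^sup>+s. f (g s) * indicator S s \<partial>count_space UNIV) \<le> (\<integral>\<^sup>+x. f x \<partial>count_space UNIV)"
proof -
  have "(\<integral>\<^sup>+s. f (g s) * indicator S s \<partial>count_space UNIV) = (\<integral>\<^sup>+s. f (g s) \<partial>count_space S)"
    by (simp add: nn_integral_count_space_indicator)
  also have "\<dots> = (\<integral>\<^sup>+x. f x \<partial>count_space (g ` S))"
    by (rule nn_integral_bij_count_space) (use assms in \<open>simp add: bij_betw_def\<close>)
  also have "\<dots> = (\<integral>\<^sup>+x. f x * indicator (g ` S) x \<partial>count_space UNIV)"
    by (simp add: nn_integral_count_space_indicator)
  also have "\<dots> \<le> (\<integral>\<^sup>+x. f x \<partial>count_space UNIV)"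
    by (intro nn_integral_mono) (auto simp: indicator_def)
  finally show ?thesis .
qed

text \<open>Choosing one preimage for each point of the support gives an injection; further
  preimages only enlarge the right side.\<close>

lemma nn_integral_count_space_le_surj:
  assumes "\<And>x. f x \<noteq> 0 \<Longrightarrow> \<exists>t\<in>T. g t = x"
  shows "(\<integral>\<^sup>+x. f x \<partial>count_space UNIV) \<le> (\<integral>\<^sup>+t. f (g t) * indicator T t \<partial>count_space UNIV)"
proof -
  obtain h where h: "\<And>x. f x \<noteq> 0 \<Longrightarrow> h x \<in> T \<and> g (h x) = x"
    using assms by metis
  let ?X = "{x. f x \<noteq> 0}"
  have inj: "inj_on h ?X" using h by (metis (mono_tags, lifting) inj_onI mem_Collect_eq)
  have "(\<integral>\<^sup>+x. f x \<partial>count_space UNIV)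
      = (\<integral>\<^sup>+x. (f (g (h x)) * indicator T (h x)) * indicator ?X x \<partial>count_space UNIV)"
    by (intro nn_integral_cong) (use h in \<open>auto simp: indicator_def\<close>)
  also have "\<dots> \<le> (\<integral>\<^sup>+t. f (g t) * indicator T t \<partial>count_space UNIV)"
    by (rule nn_integral_count_space_inj_le[OF inj])
  finally show ?thesis .
qed

lemma nn_integral_count_space_Cons:
  fixes f :: "'a list \<Rightarrow> ennreal"
  assumes "f [] = 0"
  shows "(\<integral>\<^sup>+xs. f xs \<partial>count_space UNIV) = (\<integral>\<^sup>+y. \<integral>\<^sup>+ys. f (y # ys) \<partial>count_space UNIV \<partial>count_space UNIV)"
proof -
  let ?c = "\<lambda>(y :: 'a, ys). y # ys"
  have "(\<integral>\<^sup>+xs. f xs \<partial>count_space UNIV) = (\<integral>\<^sup>+xs. f xs \<partial>count_space (range ?c))"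
  proof (rule nn_integral_count_space_eq)
    fix xs assume "xs \<in> UNIV - range ?c"
    hence "xs = []" by (cases xs) auto
    thus "f xs = 0" using assms by simp
  qed auto
  also have "\<dots> = (\<integral>\<^sup>+p. f (?c p) \<partial>count_space UNIV)"
    by (rule nn_integral_bij_count_space[symmetric]) (auto simp: bij_betw_def inj_on_def)
  also have "\<dots> = (\<integral>\<^sup>+y. \<integral>\<^sup>+ys. f (y # ys) \<partial>count_space UNIV \<partial>count_space UNIV)"
    by (simp flip: nn_integral_fst_count_space)
  finally show ?thesis .
qed

lemma neighbours_iff:
  "neighbours x y \<longleftrightarrow> (\<exists>i. y = x + axis i 1 \<or> y = x - axis i 1)"
proof
  assume "neighbours x y"
  hence s: "(\<Sum>i\<in>UNIV. \<bar>x $ i - y $ i\<bar>) = 1" by (simp add: neighbours_def)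
  have "\<exists>i. x $ i \<noteq> y $ i"
  proof (rule ccontr)
    assume "\<nexists>i. x $ i \<noteq> y $ i"
    with s show False by simp
  qed
  then obtain i where i: "x $ i \<noteq> y $ i" by blast
  have "(\<Sum>i\<in>UNIV. \<bar>x $ i - y $ i\<bar>) = \<bar>x $ i - y $ i\<bar> + (\<Sum>j\<in>UNIV - {i}. \<bar>x $ j - y $ j\<bar>)"
    by (rule sum.remove) auto
  moreover have "0 \<le> (\<Sum>j\<in>UNIV - {i}. \<bar>x $ j - y $ j\<bar>)" by (rule sum_nonneg) simp
  moreover have "1 \<le> \<bar>x $ i - y $ i\<bar>" using i by linarith
  ultimately have "\<bar>x $ i - y $ i\<bar> = 1" and "(\<Sum>j\<in>UNIV - {i}. \<bar>x $ j - y $ j\<bar>) = 0"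
    using s by linarith+
  hence j: "\<And>j. j \<noteq> i \<Longrightarrow> x $ j = y $ j" by (subst (asm) sum_nonneg_eq_0_iff) auto
  from \<open>\<bar>x $ i - y $ i\<bar> = 1\<close> consider "y $ i = x $ i + 1" | "y $ i = x $ i - 1" by linarith
  hence "y = x + axis i 1 \<or> y = x - axis i 1"
    by cases (use j in \<open>auto simp: vec_eq_iff axis_def\<close>)
  thus "\<exists>i. y = x + axis i 1 \<or> y = x - axis i 1" ..
next
  assume "\<exists>i. y = x + axis i 1 \<or> y = x - axis i 1"
  moreover have "x - axis i 1 = x + axis i (-1)" for i
    by (simp add: vec_eq_iff axis_def)
  ultimately have "\<exists>i c. y = x + axis i c \<and> \<bar>c\<bar> = 1"
    by (metis abs_1 abs_minus)
  then obtain i c where y: "y = x + axis i c" and c: "\<bar>c\<bar> = 1" by blast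
  have "(\<Sum>j\<in>UNIV. \<bar>x $ j - y $ j\<bar>) = (\<Sum>j\<in>UNIV. if j = i then 1 else 0)"
    by (rule sum.cong) (use y c in \<open>auto simp: axis_def\<close>)
  thus "neighbours x y" by (simp add: neighbours_def)
qed

text \<open>The 2d neighbours are distinct, so the sum over target vertices is one over signed
  directions.\<close>

lemma nn_integral_srw_trans:
  fixes x :: "int ^ 'd::finite" and \<phi> :: "int ^ 'd \<Rightarrow> ennreal"
  shows "(\<integral>\<^sup>+y. ennreal (srw_trans x y) * \<phi> y \<partial>count_space UNIV) =
    ennreal (1 / (2 * real CARD('d))) * (\<Sum>i\<in>UNIV. \<phi> (x + axis i 1) + \<phi> (x - axis i 1))"
proof -
  let ?p = "\<lambda>i::'d. x + axis i 1" and ?m = "\<lambda>i::'d. x - axis i 1"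
  let ?e = "ennreal (1 / (2 * real CARD('d)))"
  have inj: "inj ?p" "inj ?m" by (auto simp: inj_on_def axis_eq_axis)
  have disj: "range ?p \<inter> range ?m = {}"
  proof (rule ccontr)
    assume "range ?p \<inter> range ?m \<noteq> {}"
    then obtain i j where "x + axis i 1 = x - axis j 1" by auto
    from arg_cong[OF this, of "\<lambda>v. v $ i"] show False by (simp add: axis_def split: if_splits)
  qed
  have "(\<integral>\<^sup>+y. ennreal (srw_trans x y) * \<phi> y \<partial>count_space UNIV) =
      (\<Sum>y\<in>range ?p \<union> range ?m. ennreal (srw_trans x y) * \<phi> y)"
    by (rule nn_integral_count_space') (auto simp: srw_trans_def neighbours_iff)
  also have "\<dots> = (\<Sum>y\<in>range ?p \<union> range ?m. ?e * \<phi> y)"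
    by (rule sum.cong) (auto simp: srw_trans_def neighbours_iff)
  also have "\<dots> = (\<Sum>i\<in>UNIV. ?e * \<phi> (?p i)) + (\<Sum>i\<in>UNIV. ?e * \<phi> (?m i))"
    by (subst sum.union_disjoint) (auto simp: disj sum.reindex inj)
  finally show ?thesis by (simp add: sum.distrib distrib_left sum_distrib_left)
qed

section \<open>Path weights and the Green function\<close>

text \<open>The start is kept outside the list, so that paths are joined by appending lists without
  repeating the common vertex.\<close>

primrec path_weight :: "int ^ 'd::finite \<Rightarrow> (int ^ 'd) list \<Rightarrow> real" where
  "path_weight x [] = 1"
| "path_weight x (y # ys) = srw_trans x y * path_weight y ys"

lemma srw_trans_nonneg: "0 \<le> srw_trans x y"
  by (simp add: srw_trans_def)

lemma path_weight_nonneg: "0 \<le> path_weight x ys"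
  by (induction ys arbitrary: x) (auto simp: srw_trans_nonneg)

lemma path_weight_append:
  "path_weight x (us @ vs) = path_weight x us * path_weight (last (x # us)) vs"
  by (induction us arbitrary: x) auto

text \<open>Splitting off the first step reproduces the recursion of \<open>srw_power\<close>, which
  by translation invariance sees only the displacement.\<close>

lemma walk_sum_eq_srw_power:
  "(\<integral>\<^sup>+vs. ennreal (path_weight z vs) * indicator {vs. length vs = m \<and> last (z # vs) = w} vs \<partial>count_space UNIV)
    = ennreal (srw_power m (z - w))"
proof (induction m arbitrary: z)
  case 0
  have "(\<integral>\<^sup>+vs. ennreal (path_weight z vs) * indicator {vs. length vs = 0 \<and> last (z # vs) = w} vs \<partial>count_space UNIV)
      = (\<Sum>vs\<in>{[]}. ennreal (path_weight z vs) * indicator {vs. length vs = 0 \<and> last (z # vs) = w} vs)"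
    by (rule nn_integral_count_space') (auto simp: indicator_def)
  thus ?case by (simp add: indicator_def)
next
  case (Suc m)
  let ?f = "\<lambda>z m vs. ennreal (path_weight z vs) * indicator {vs. length vs = m \<and> last (z # vs) = w} vs"
  have "(\<integral>\<^sup>+vs. ?f z (Suc m) vs \<partial>count_space UNIV)
      = (\<integral>\<^sup>+y. \<integral>\<^sup>+vs. ennreal (srw_trans z y) * ?f y m vs \<partial>count_space UNIV \<partial>count_space UNIV)"
    by (subst nn_integral_count_space_Cons)
       (auto intro!: nn_integral_cong simp: ennreal_mult srw_trans_nonneg path_weight_nonneg mult.assoc indicator_def)
  also have "\<dots> = (\<integral>\<^sup>+y. ennreal (srw_trans z y) * ennreal (srw_power m (y - w)) \<partial>count_space UNIV)"
    by (simp only: nn_integral_cmult[OF borel_measurable_count_space] Suc.IH)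
  also have "\<dots> = ennreal (1 / (2 * real CARD('a))) *
      (\<Sum>i\<in>UNIV. ennreal (srw_power m (z + axis i 1 - w)) + ennreal (srw_power m (z - axis i 1 - w)))"
    by (rule nn_integral_srw_trans)
  also have "\<dots> = ennreal (1 / (2 * real CARD('a))) *
      ennreal (\<Sum>i\<in>UNIV. srw_power m (z + axis i 1 - w) + srw_power m (z - axis i 1 - w))"
    by (simp add: srw_power_nonneg flip: ennreal_plus)
  also have "\<dots> = ennreal (1 / (2 * real CARD('a)) *
      (\<Sum>i\<in>UNIV. srw_power m (z + axis i 1 - w) + srw_power m (z - axis i 1 - w)))"
    by (rule ennreal_mult[symmetric]) (auto intro!: sum_nonneg add_nonneg_nonneg srw_power_nonneg)
  also have "\<dots> = ennreal (srw_power (Suc m) (z - w))"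
  proof -
    have "z + axis i 1 - w = z - w + axis i 1" "z - axis i 1 - w = z - w - axis i 1" for i
      by (simp_all add: algebra_simps)
    thus ?thesis by (simp only: srw_power.simps mult_1 times_divide_eq_left)
  qed
  finally show ?case .
qed

lemma walk_sum_eq_green:
  "(\<integral>\<^sup>+vs. ennreal (path_weight z vs) * indicator {vs. last (z # vs) = w} vs \<partial>count_space UNIV) = green (z - w)"
proof -
  have "(\<integral>\<^sup>+vs. ennreal (path_weight z vs) * indicator {vs. last (z # vs) = w} vs \<partial>count_space UNIV)
     = (\<integral>\<^sup>+vs. (\<Sum>m. ennreal (path_weight z vs) * indicator {vs. length vs = m \<and> last (z # vs) = w} vs) \<partial>count_space UNIV)"
  proof (rule nn_integral_cong)
    fix vs
    have "(\<Sum>m. (ennreal (path_weight z vs) * indicator {vs. last (z # vs) = w} vs) * indicator {m} (length vs))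
        = ennreal (path_weight z vs) * indicator {vs. last (z # vs) = w} vs"
      by (rule suminf_cmult_indicator) (auto simp: disjoint_family_on_def)
    moreover have "indicator {vs. last (z # vs) = w} vs * indicator {m} (length vs)
       = (indicator {vs. length vs = m \<and> last (z # vs) = w} vs :: ennreal)" for m
      by (auto simp: indicator_def)
    ultimately show "ennreal (path_weight z vs) * indicator {vs. last (z # vs) = w} vs =
      (\<Sum>m. ennreal (path_weight z vs) * indicator {vs. length vs = m \<and> last (z # vs) = w} vs)"
      by (simp only: mult.assoc)
  qed
  also have "\<dots> = green (z - w)"
    by (simp only: nn_integral_suminf[OF borel_measurable_count_space] walk_sum_eq_srw_power green_def)
  finally show ?thesis .
qed

section \<open>Closed paths at the origin and their excursions\<close>

definition returning_sum :: "(int ^ 'd::finite) set \<Rightarrow> ennreal" where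
  "returning_sum F = (\<integral>\<^sup>+zs. ennreal (path_weight 0 zs) *
     indicator {zs. last (0 # zs) = 0 \<and> set zs \<inter> F \<noteq> {}} zs \<partial>count_space UNIV)"

text \<open>An excursion is coded by its interior: neither the start at the origin nor the final
  return belongs to \<open>ys\<close>.\<close>

definition excursion_sum :: "(int ^ 'd::finite) set \<Rightarrow> ennreal" where
  "excursion_sum F = (\<integral>\<^sup>+ys. ennreal (path_weight 0 (ys @ [0])) *
     indicator {ys. 0 \<notin> set ys \<and> set ys \<inter> F \<noteq> {}} ys \<partial>count_space UNIV)"

text \<open>A path of k steps to z is followed by any path from z back to the origin. Since k is
  fixed, the cut can be recovered from the concatenation, and no closed path is counted
  twice.\<close>

lemma returning_sum_ge:
  fixes Z :: "(int ^ 'd::finite) set"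
  assumes "finite Z" "Z \<subseteq> F" "0 \<notin> Z"
  shows "(\<Sum>z\<in>Z. ennreal (srw_power k (- z)) * green z) \<le> returning_sum F"
proof -
  let ?f = "\<lambda>zs::(int^'d) list. ennreal (path_weight 0 zs) * indicator {zs. last (0 # zs) = 0 \<and> set zs \<inter> F \<noteq> {}} zs"
  let ?S = "{p :: (int ^ 'd) list \<times> (int ^ 'd) list. length (fst p) = k}"
  let ?A = "\<lambda>z us. ennreal (path_weight 0 us) * indicator {us. length us = k \<and> last (0 # us) = z} us"
  let ?B = "\<lambda>z vs. ennreal (path_weight z vs) * indicator {vs. last (z # vs) = 0} vs"
  have "(\<Sum>z\<in>Z. ennreal (srw_power k (- z)) * green z) =
      (\<Sum>z\<in>Z. (\<integral>\<^sup>+us. ?A z us \<partial>count_space UNIV) * (\<integral>\<^sup>+vs. ?B z vs \<partial>count_space UNIV))"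
    by (subst walk_sum_eq_srw_power, subst walk_sum_eq_green) simp
  also have "\<dots> = (\<Sum>z\<in>Z. \<integral>\<^sup>+us. \<integral>\<^sup>+vs. ?A z us * ?B z vs \<partial>count_space UNIV \<partial>count_space UNIV)"
    by (simp add: nn_integral_cmult nn_integral_multc)
  also have "\<dots> = (\<Sum>z\<in>Z. \<integral>\<^sup>+p. ?A z (fst p) * ?B z (snd p) \<partial>count_space UNIV)"
    by (simp flip: nn_integral_fst_count_space)
  also have "\<dots> = (\<integral>\<^sup>+p. (\<Sum>z\<in>Z. ?A z (fst p) * ?B z (snd p)) \<partial>count_space UNIV)"
    by (rule nn_integral_sum[symmetric]) auto
  also have "\<dots> \<le> (\<integral>\<^sup>+p. ?f (fst p @ snd p) * indicator ?S p \<partial>count_space UNIV)"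
  proof (rule nn_integral_mono)
    fix p :: "(int ^ 'd) list \<times> (int ^ 'd) list"
    obtain us vs where p: "p = (us, vs)" by (cases p)
    \<comment> \<open>Only the end point of \<open>us\<close> can be the cut vertex.\<close>
    have single: "(\<Sum>z\<in>Z. ?A z us * ?B z vs) =
        (\<Sum>z\<in>Z. if z = last (0 # us) then ?A z us * ?B z vs else 0)"
      by (rule sum.cong) (auto simp: indicator_def)
    also have "\<dots> = (if last (0 # us) \<in> Z then ?A (last (0 # us)) us * ?B (last (0 # us)) vs else 0)"
      using assms(1) by (rule sum.delta)
    also have "\<dots> \<le> ?f (us @ vs) * indicator ?S (us, vs)"
    proof (cases "last (0 # us) \<in> Z \<and> length us = k \<and> last (last (0 # us) # vs) = 0")
      case True
      \<comment> \<open>The cut vertex differs from the origin, hence it is not the omitted start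
        but an entry of the list.\<close>
      hence "us \<noteq> []" using assms(3) by auto
      hence "last us \<in> set (us @ vs) \<inter> F" using True assms(2) by auto
      moreover have "last (0 # us @ vs) = 0" using True \<open>us \<noteq> []\<close> by (auto split: if_splits)
      ultimately show ?thesis using True
        by (auto simp: path_weight_append ennreal_mult path_weight_nonneg indicator_def)
    qed (auto simp: indicator_def)
    finally show "(\<Sum>z\<in>Z. ?A z (fst p) * ?B z (snd p)) \<le> ?f (fst p @ snd p) * indicator ?S p"
      by (simp only: p fst_conv snd_conv)
  qed
  also have "\<dots> \<le> (\<integral>\<^sup>+zs. ?f zs \<partial>count_space UNIV)"
    by (rule nn_integral_count_space_inj_le) (auto simp: inj_on_def)
  finally show ?thesis by (simp add: returning_sum_def)
qed

text \<open>The path is cut at the last visit to w before a chosen occurrence of x and at the first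
  visit after it.\<close>

lemma closed_path_decomposition:
  assumes "last (w # zs) = w" "x \<in> set zs" "x \<noteq> w"
  obtains as ys bs where "zs = as @ (ys @ [w]) @ bs" "last (w # as) = w" "w \<notin> set ys" "x \<in> set ys"
    "last (w # bs) = w"
proof -
  obtain p q where zs: "zs = p @ x # q" using assms(2) by (meson split_list)
  have "last (x # q) = w" using assms(1) by (simp add: zs)
  hence "w \<in> set (x # q)" using last_in_set[of "x # q"] by simp
  hence "w \<in> set q" using assms(3) by auto
  then obtain q1 bs where q: "q = q1 @ w # bs" "w \<notin> set q1" by (meson split_list_first)
  obtain as p1 where p: "p = as @ p1" "last (w # as) = w" "w \<notin> set p1"
  proof (cases "w \<in> set p")
    case True
    then obtain a b where "p = a @ w # b" "w \<notin> set b" by (meson split_list_last)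
    thus thesis by (intro that[of "a @ [w]" b]) auto
  next
    \<comment> \<open>With no visit to w in \<open>p\<close>, the excursion begins at the initial
      vertex.\<close>
    case False
    thus thesis by (intro that[of "[]" p]) auto
  qed
  show thesis
  proof (rule that[of as "p1 @ x # q1" bs])
    show "zs = as @ ((p1 @ x # q1) @ [w]) @ bs" by (simp add: zs p q)
    show "last (w # bs) = w" using assms(1) by (simp add: zs q)
  qed (use p q assms(3) in auto)
qed

lemma nn_integral_count_space_prod_mult:
  fixes f :: "'a \<Rightarrow> ennreal" and g :: "'b \<Rightarrow> ennreal"
  shows "(\<integral>\<^sup>+p. f (fst p) * g (snd p) \<partial>count_space UNIV)
    = (\<integral>\<^sup>+x. f x \<partial>count_space UNIV) * (\<integral>\<^sup>+y. g y \<partial>count_space UNIV)"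
proof -
  have "(\<integral>\<^sup>+p. f (fst p) * g (snd p) \<partial>count_space UNIV)
    = (\<integral>\<^sup>+x. \<integral>\<^sup>+y. f x * g y \<partial>count_space UNIV \<partial>count_space UNIV)"
    using nn_integral_fst_count_space[of "\<lambda>p. f (fst p) * g (snd p)"] by simp
  thus ?thesis
    by (simp only: nn_integral_cmult[OF borel_measurable_count_space] nn_integral_multc[OF borel_measurable_count_space])
qed

text \<open>A closed path through \<open>F\<close> splits into a closed path, an excursion from the origin that meets
  \<open>F\<close>, and another closed path.\<close>
lemma returning_sum_le:
  assumes "0 \<notin> (F :: (int ^ 'd::finite) set)"
  shows "returning_sum F \<le> green (0 :: int ^ 'd) * (excursion_sum F * green (0 :: int ^ 'd))"
proof -
  define L where "L = {vs :: (int ^ 'd) list. last (0 # vs) = 0}"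
  define E where "E = {ys :: (int ^ 'd) list. 0 \<notin> set ys \<and> set ys \<inter> F \<noteq> {}}"
  define f where "f = (\<lambda>zs::(int^'d) list. ennreal (path_weight 0 zs) * indicator {zs. last (0 # zs) = 0 \<and> set zs \<inter> F \<noteq> {}} zs)"
  define l where "l = (\<lambda>vs. ennreal (path_weight 0 vs) * indicator L vs)"
  define e where "e = (\<lambda>ys. ennreal (path_weight 0 (ys @ [0])) * indicator E ys)"
  let ?g = "\<lambda>t. fst t @ (fst (snd t) @ [0]) @ snd (snd t) :: (int ^ 'd) list"
  \<comment> \<open>Concatenation need only be surjective: a path with several excursions meeting
    \<open>F\<close> is counted repeatedly, which is harmless for an upper bound.\<close>
  have "returning_sum F \<le> (\<integral>\<^sup>+t. f (?g t) * indicator (L \<times> E \<times> L) t \<partial>count_space UNIV)"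
    unfolding returning_sum_def f_def[symmetric]
  proof (rule nn_integral_count_space_le_surj)
    fix zs assume "f zs \<noteq> 0"
    hence "last (0 # zs) = 0" and "set zs \<inter> F \<noteq> {}" 
      unfolding f_def indicator_def by (metis (mono_tags, lifting) mem_Collect_eq mult_zero_right of_bool_eq(1))+
    then obtain x where "last (0 # zs) = 0" "x \<in> set zs" "x \<in> F" by blast
    moreover from this assms have "x \<noteq> 0" by blast
    ultimately obtain as ys bs where "zs = as @ (ys @ [0]) @ bs" "last (0 # as) = 0" "0 \<notin> set ys" 
      "x \<in> set ys" "last (0 # bs) = 0" using closed_path_decomposition[of 0 zs x] by blast
    with \<open>x \<in> F\<close> have "(as, ys, bs) \<in> L \<times> E \<times> L" "?g (as, ys, bs) = zs"
      unfolding L_def E_def by auto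
    thus "\<exists>t\<in>L \<times> E \<times> L. ?g t = zs" by blast
  qed
  also have "\<dots> \<le> (\<integral>\<^sup>+t. l (fst t) * (e (fst (snd t)) * l (snd (snd t))) \<partial>count_space UNIV)"
  proof (rule nn_integral_mono)
    fix t :: "(int ^ 'd) list \<times> (int ^ 'd) list \<times> (int ^ 'd) list"
    obtain as ys bs where t: "t = (as, ys, bs)" by (cases t)
    show "f (?g t) * indicator (L \<times> E \<times> L) t \<le> l (fst t) * (e (fst (snd t)) * l (snd (snd t)))"
    proof (cases "as \<in> L \<and> ys \<in> E \<and> bs \<in> L")
      case True
      hence "last (0 # as) = 0" unfolding L_def by blast
      hence "path_weight 0 (as @ (ys @ [0]) @ bs) = path_weight 0 as * path_weight 0 ((ys @ [0]) @ bs)"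
        using path_weight_append[of 0 as "(ys @ [0]) @ bs"] by presburger
      also have "path_weight 0 ((ys @ [0]) @ bs) = path_weight 0 (ys @ [0]) * path_weight 0 bs"
        by (subst path_weight_append) simp
      finally have "ennreal (path_weight 0 (as @ (ys @ [0]) @ bs)) = ennreal (path_weight 0 as) *
          (ennreal (path_weight 0 (ys @ [0])) * ennreal (path_weight 0 bs))"
        by (simp only: ennreal_mult path_weight_nonneg mult_nonneg_nonneg)
      also have "\<dots> = l as * (e ys * l bs)" using True by (simp add: l_def e_def)
      finally have "ennreal (path_weight 0 (as @ (ys @ [0]) @ bs)) = l as * (e ys * l bs)" .
      moreover have "f (?g t) * indicator (L \<times> E \<times> L) t \<le> ennreal (path_weight 0 (as @ (ys @ [0]) @ bs))"
        unfolding f_def t by (auto simp: indicator_def)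
      ultimately show ?thesis unfolding t by simp
    next
      case False
      hence "t \<notin> L \<times> E \<times> L" unfolding t by blast
      thus ?thesis by simp
    qed
  qed
  also have "\<dots> = green (0 :: int ^ 'd) * (excursion_sum F * green (0 :: int ^ 'd))"
  proof -
    have "(\<integral>\<^sup>+vs. l vs \<partial>count_space UNIV) = green (0 :: int ^ 'd)"
      using walk_sum_eq_green[of 0 "0 :: int ^ 'd"] unfolding l_def L_def by simp
    moreover have "(\<integral>\<^sup>+ys. e ys \<partial>count_space UNIV) = excursion_sum F"
      unfolding e_def E_def excursion_sum_def ..
    ultimately show ?thesis
      by (simp only: nn_integral_count_space_prod_mult[of l "\<lambda>p. e (fst p) * l (snd p)"]
          nn_integral_count_space_prod_mult[of e l])
  qed
  finally show ?thesis .
qed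

lemma finite_card_vec:
  fixes S :: "'a set"
  assumes "finite S"
  shows "finite {z :: 'a ^ 'd::finite. \<forall>i. z $ i \<in> S}" "card {z :: 'a ^ 'd. \<forall>i. z $ i \<in> S} = card S ^ CARD('d)"
proof -
  have "bij_betw vec_lambda (UNIV \<rightarrow>\<^sub>E S) {z :: 'a ^ 'd. \<forall>i. z $ i \<in> S}"
    by (rule bij_betwI[where g=vec_nth]) auto
  moreover have "finite ((UNIV :: 'd set) \<rightarrow>\<^sub>E S)" using assms by (intro finite_PiE) auto
  moreover have "card ((UNIV :: 'd set) \<rightarrow>\<^sub>E S) = card S ^ CARD('d)" by (subst card_PiE) auto
  ultimately show "finite {z :: 'a ^ 'd. \<forall>i. z $ i \<in> S}" "card {z :: 'a ^ 'd. \<forall>i. z $ i \<in> S} = card S ^ CARD('d)"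
    by (simp_all add: bij_betw_finite bij_betw_same_card[symmetric])
qed

section \<open>Closed paths reaching distance n\<close>

text \<open>The exterior together with the sphere is used so that a whole cube of cut vertices lies
  in it; \<open>path_crosses_sphere\<close> later recovers the sphere.\<close>

definition far :: "nat \<Rightarrow> (int ^ 'd::finite) set" where
  "far n = {z. int n \<le> sup_norm z}"

lemma sup_norm_ge: "\<bar>z $ i\<bar> \<le> sup_norm z"
  unfolding sup_norm_def by (rule Max_ge) auto

lemma sup_norm_le_iff: "sup_norm z \<le> c \<longleftrightarrow> (\<forall>i. \<bar>z $ i\<bar> \<le> c)"
  unfolding sup_norm_def by (subst Max_le_iff) auto

lemma sup_norm_attained: "\<exists>i. sup_norm z = \<bar>z $ i\<bar>"
proof -
  have "sup_norm z \<in> range (\<lambda>i. \<bar>z $ i\<bar>)" unfolding sup_norm_def by (rule Max_in) auto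
  thus ?thesis by auto
qed

lemma zero_notin_far: "1 \<le> n \<Longrightarrow> (0 :: int ^ 'd::finite) \<notin> far n"
  using sup_norm_le_iff[of "0 :: int ^ 'd" 0] by (auto simp: far_def)

text \<open>Averaging \<open>returning_sum_ge\<close> over k with Poisson weights, of total mass
  one, turns step probabilities into the heat kernel. The sum over the cube is then of order n^d *
  n^(-d) * n^(2-d).\<close>

lemma returning_sum_far_lower_bound:
  assumes "1 \<le> n"
  shows "ennreal (256 * real CARD('d::finite) * (real n)\<^sup>2 * (1 / 644 ^ 2) ^ CARD('d) / real n ^ CARD('d))
    \<le> returning_sum (far n :: (int ^ 'd) set)"
proof -
  let ?D = "CARD('d)" and ?R = "returning_sum (far n :: (int ^ 'd) set)"
  let ?t = "256 * real CARD('d) * (real n)\<^sup>2"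
  let ?p = "(1 / (644 * real n)) ^ ?D"
  let ?Z = "{z :: int ^ 'd. \<forall>i. z $ i \<in> {int n..2 * int n}}"
  have Z: "finite ?Z" "card ?Z = (n + 1) ^ ?D"
    using finite_card_vec[of "{int n..2 * int n}"] by (simp_all add: nat_add_distrib)
  have sub: "?Z \<subseteq> far n"
  proof
    fix z assume "z \<in> ?Z"
    hence "int n \<le> z $ undefined" by auto
    hence "int n \<le> \<bar>z $ undefined\<bar>" by linarith
    thus "z \<in> far n" using sup_norm_ge[of z undefined] by (simp add: far_def)
  qed
  have notin: "0 \<notin> ?Z" using sub zero_notin_far[OF assms] by blast
  have bound: "\<bar>z $ i\<bar> \<le> 2 * int n" "\<bar>(- z) $ i\<bar> \<le> 2 * int n" if "z \<in> ?Z" for z i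
    using that[THEN CollectD, rule_format, of i] by auto
  have green_z: "ennreal (?t * ?p) * ennreal (srw_kernel ?t (- z)) \<le> (\<Sum>k. ennreal (poisson_weight ?t k) * (ennreal (srw_power k (- z)) * green z))"
    if "z \<in> ?Z" for z
  proof -
    have "ennreal (?t * ?p) * ennreal (srw_kernel ?t (- z)) \<le> green z * ennreal (srw_kernel ?t (- z))"
      by (intro mult_right_mono green_lower_bound assms bound that) auto
    also have "\<dots> = (\<Sum>k. green z * (ennreal (poisson_weight ?t k) * ennreal (srw_power k (- z))))"
      by (subst ennreal_srw_kernel) auto
    finally show ?thesis by (simp only: mult_ac)
  qed
  have "(\<Sum>z\<in>?Z. ennreal (?t * ?p) * ennreal ?p)
      \<le> (\<Sum>z\<in>?Z. \<Sum>k. ennreal (poisson_weight ?t k) * (ennreal (srw_power k (- z)) * green z))"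
  proof (intro sum_mono)
    fix z assume z: "z \<in> ?Z"
    have "ennreal ?p \<le> ennreal (srw_kernel ?t (- z))"
      by (intro ennreal_leI srw_kernel_lower_bound assms bound(2)[OF z]) auto
    hence "ennreal (?t * ?p) * ennreal ?p \<le> ennreal (?t * ?p) * ennreal (srw_kernel ?t (- z))"
      by (rule mult_left_mono) simp
    also have "\<dots> \<le> (\<Sum>k. ennreal (poisson_weight ?t k) * (ennreal (srw_power k (- z)) * green z))"
      by (rule green_z[OF z])
    finally show "ennreal (?t * ?p) * ennreal ?p
      \<le> (\<Sum>k. ennreal (poisson_weight ?t k) * (ennreal (srw_power k (- z)) * green z))" .
  qed
  also have "\<dots> = (\<Sum>k. \<Sum>z\<in>?Z. ennreal (poisson_weight ?t k) * (ennreal (srw_power k (- z)) * green z))"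
    by (subst suminf_sum) auto
  also have "\<dots> \<le> (\<Sum>k. ennreal (poisson_weight ?t k) * ?R)"
  proof (rule suminf_le)
    fix k
    have "(\<Sum>z\<in>?Z. ennreal (srw_power k (- z)) * green z) \<le> ?R"
      by (rule returning_sum_ge[OF Z(1) sub notin])
    thus "(\<Sum>z\<in>?Z. ennreal (poisson_weight ?t k) * (ennreal (srw_power k (- z)) * green z))
        \<le> ennreal (poisson_weight ?t k) * ?R"
      by (simp only: sum_distrib_left[symmetric]) (rule mult_left_mono, auto)
  qed auto
  also have "\<dots> = ?R"
    using suminf_ennreal_eq[OF poisson_weight_nonneg[of ?t] poisson_weight_sums[of ?t]] by simp
  finally have *: "of_nat (card ?Z) * (ennreal (?t * ?p) * ennreal ?p) \<le> ?R" by simp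
  \<comment> \<open>One factor \<open>?p\<close> comes from the heat kernel and one from the Green
    function, hence 644^2; the cube has at least n^d points.\<close>
  have "256 * real ?D * (real n)\<^sup>2 * (1 / 644 ^ 2) ^ ?D / real n ^ ?D = real n ^ ?D * (?t * ?p * ?p)"
  proof -
    have "(644::real) ^ ?D * 644 ^ ?D = 414736 ^ ?D" by (simp flip: power_mult_distrib)
    thus ?thesis using assms by (simp add: power_mult_distrib power_divide power2_eq_square divide_simps)
  qed
  also have "\<dots> \<le> real (card ?Z) * (?t * ?p * ?p)"
    unfolding Z(2) by (intro mult_right_mono) (auto intro!: power_mono mult_nonneg_nonneg)
  finally have "ennreal (256 * real ?D * (real n)\<^sup>2 * (1 / 644 ^ 2) ^ ?D / real n ^ ?D) \<le> ennreal (real (card ?Z) * (?t * ?p * ?p))"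
    by (rule ennreal_leI)
  also have "\<dots> = of_nat (card ?Z) * (ennreal (?t * ?p) * ennreal ?p)"
    by (simp add: ennreal_mult ennreal_of_nat_eq_real_of_nat mult.assoc)
  also note *
  finally show ?thesis .
qed


section \<open>Rotations and excursions\<close>

lemma sup_norm_neighbours: "neighbours x y \<Longrightarrow> sup_norm y \<le> sup_norm x + 1"
proof -
  assume "neighbours x y"
  then obtain j where "y = x + axis j 1 \<or> y = x - axis j 1" by (auto simp: neighbours_iff)
  hence "\<bar>y $ i\<bar> \<le> \<bar>x $ i\<bar> + 1" for i by (auto simp: axis_def)
  hence "\<bar>y $ i\<bar> \<le> sup_norm x + 1" for i
    using sup_norm_ge[of x i] by (metis add_right_mono order_trans)
  thus ?thesis by (simp add: sup_norm_le_iff)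
qed

text \<open>A step that pushes a coordinate of maximal modulus outwards leaves the box.\<close>

lemma sup_norm_eq_inner_boundary:
  assumes "sup_norm z = int n"
  shows "z \<in> inner_boundary (lattice_box 0 n)"
proof -
  obtain i where i: "sup_norm z = \<bar>z $ i\<bar>" using sup_norm_attained by blast
  have "\<exists>y. neighbours z y \<and> \<bar>y $ i\<bar> = int n + 1"
  proof (cases "0 \<le> z $ i")
    case True
    thus ?thesis using i assms by (intro exI[of _ "z + axis i 1"]) (auto simp: neighbours_iff axis_def)
  next
    case False
    thus ?thesis using i assms by (intro exI[of _ "z - axis i 1"]) (auto simp: neighbours_iff axis_def)
  qed
  then obtain y where "neighbours z y" "\<bar>y $ i\<bar> = int n + 1" by blast
  moreover from this have "\<not> sup_norm y \<le> int n" using sup_norm_ge[of y i] by linarith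
  ultimately show ?thesis using assms by (auto simp: inner_boundary_def lattice_box_def)
qed

text \<open>A discrete intermediate value argument: the norm grows by at most one per step, so level
  n cannot be skipped.\<close>

lemma path_crosses_sphere:
  assumes "path_weight x ys \<noteq> 0" "sup_norm x < int n" "set ys \<inter> far n \<noteq> {}"
  shows "set ys \<inter> inner_boundary (lattice_box 0 n) \<noteq> {}"
  using assms
proof (induction ys arbitrary: x)
  case (Cons y ys)
  hence "neighbours x y" "path_weight y ys \<noteq> 0" by (auto simp: srw_trans_def split: if_splits)
  hence le: "sup_norm y \<le> int n" using sup_norm_neighbours[of x y] Cons.prems by simp
  show ?case
  proof (cases "sup_norm y = int n")
    case True
    thus ?thesis using sup_norm_eq_inner_boundary by auto
  next
    case False
    hence "sup_norm y < int n" using le by simp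
    moreover from this have "set ys \<inter> far n \<noteq> {}" using Cons.prems by (auto simp: far_def)
    ultimately show ?thesis using Cons.IH[of y] \<open>path_weight y ys \<noteq> 0\<close> by auto
  qed
qed simp

section \<open>Based loops and their rotations\<close>

lemma path_weight_eq_prod: "path_weight x zs = (\<Prod>i<length zs. srw_trans ((x # zs) ! i) (zs ! i))"
  by (induction zs arbitrary: x) (simp_all add: prod.lessThan_Suc_shift del: prod.lessThan_Suc)

text \<open>The wrap-around modulo the length becomes the appended closing step.\<close>

lemma cyclic_prod_eq_path_weight:
  "(\<Prod>i<length (x # ys). srw_trans ((x # ys) ! i) ((x # ys) ! (Suc i mod length (x # ys)))) = path_weight x (ys @ [x])"
  unfolding path_weight_eq_prod
proof (rule prod.cong)
  fix i assume "i \<in> {..<length (ys @ [x])}"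
  hence i: "i < Suc (length ys)" by simp
  have "(x # ys @ [x]) ! i = (x # ys) ! i"
    using i nth_append[of "x # ys" "[x]" i] by simp
  moreover have "(ys @ [x]) ! i = (x # ys) ! (Suc i mod Suc (length ys))"
  proof (cases "i = length ys")
    case False
    hence "i < length ys" using i by simp
    thus ?thesis by (simp add: nth_append)
  qed (simp add: nth_append)
  ultimately show "srw_trans ((x # ys) ! i) ((x # ys) ! (Suc i mod length (x # ys)))
      = srw_trans ((x # ys @ [x]) ! i) ((ys @ [x]) ! i)" by simp
qed simp

lemma based_loop_weight_Cons:
  "based_loop_weight 0 (x # ys) = path_weight x (ys @ [x]) / real (length (x # ys))"
  unfolding based_loop_weight_def cyclic_prod_eq_path_weight by simp

lemma based_loop_weight_rotate1: "based_loop_weight 0 (rotate1 xs) = based_loop_weight 0 xs"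
proof (cases xs)
  case (Cons x ys)
  show ?thesis
  proof (cases ys)
    case (Cons y zs)
    have "based_loop_weight 0 (y # zs @ [x]) = based_loop_weight 0 (x # y # zs)"
      using path_weight_append[of y "zs @ [x]" "[y]"]
      unfolding based_loop_weight_Cons by simp
    thus ?thesis using Cons \<open>xs = x # ys\<close> by simp
  qed (use Cons in simp)
qed simp

lemma based_loop_weight_rotate: "based_loop_weight 0 (rotate k xs) = based_loop_weight 0 xs"
  by (induction k) (simp_all add: based_loop_weight_rotate1)

lemma based_loop_weight_neighbours:
  assumes "based_loop_weight 0 xs \<noteq> 0" "i < length xs"
  shows "neighbours (xs ! i) (xs ! (Suc i mod length xs))"
proof -
  have "(\<Prod>i<length xs. srw_trans (xs ! i) (xs ! (Suc i mod length xs))) \<noteq> 0"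
    using assms(1) by (auto simp: based_loop_weight_def)
  hence "srw_trans (xs ! i) (xs ! (Suc i mod length xs)) \<noteq> 0"
    using assms(2) by (simp add: prod_zero_iff)
  thus ?thesis by (simp add: srw_trans_def split: if_splits)
qed

lemma neighbours_irrefl: "\<not> neighbours x x"
  by (simp add: neighbours_def)

lemma based_loops_if_weight:
  "based_loop_weight 0 xs \<noteq> 0 \<Longrightarrow> 2 \<le> length xs \<Longrightarrow> xs \<in> based_loops"
  using based_loop_weight_neighbours[of xs] neighbours_irrefl by (fastforce simp: based_loops_def)

text \<open>Since x occurs only once in the second list, its position after rotation reveals the
  amount of rotation, which can then be undone.\<close>

lemma rotate_Cons_inject:
  fixes x :: 'a
  assumes eq: "rotate k (x # ys) = rotate k' (x # ys')"
    and notin: "x \<notin> set ys'" and k: "k < Suc (length ys)" "k' < Suc (length ys')"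
  shows "k = k'" "ys = ys'"
proof -
  have len: "length ys = length ys'" using arg_cong[OF eq, of length] by simp
  define N where "N = Suc (length ys)"
  \<comment> \<open>The index to which rotation by k carries the leading x.\<close>
  define j where "j = (N - k) mod N"
  have N: "k < N" "k' < N" "N = Suc (length ys')" using k len by (simp_all add: N_def)
  have j: "j < N" "(k + j) mod N = 0" using N by (auto simp: j_def mod_add_right_eq N_def)
  have "rotate k (x # ys) ! j = x"
    using j by (subst nth_rotate) (auto simp: N_def)
  hence "(x # ys') ! ((k' + j) mod N) = x"
    unfolding eq using j N by (subst (asm) nth_rotate) auto
  moreover have "(x # ys') ! m \<in> set ys'" if "m \<noteq> 0" "m < N" for m
    using that by (cases m) (auto simp: N(3))
  moreover have "(k' + j) mod N < N" using N by simp
  ultimately have k'j: "(k' + j) mod N = 0" using notin by metis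
  show "k = k'"
  proof (cases "j = 0")
    case True
    thus ?thesis using j k'j N by simp
  next
    case False
    \<comment> \<open>For 0 < j < N and i < N the sum lies strictly between 0 and 2N, so N is the
      only multiple available.\<close>
    have "i + j = N" if "(i + j) mod N = 0" "i < N" for i
    proof -
      obtain q where q: "i + j = N * q" using \<open>(i + j) mod N = 0\<close> by (auto elim: dvdE)
      have "0 < N * q" "N * q < N * 2" using q that j False by linarith+
      hence "q = 1" by (simp add: mult_less_cancel1 less_2_cases_iff)
      thus ?thesis using q by simp
    qed
    from this[OF j(2) N(1)] this[OF k'j N(2)] show ?thesis by simp
  qed
  have rot: "rotate (N - k) (rotate k zs) = zs" if "length zs = N" for zs :: "'a list"
    using N(1) that by (simp add: rotate_rotate rotate_id)
  have "x # ys = rotate (N - k) (rotate k (x # ys))"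
    by (rule rot[symmetric]) (simp add: N_def)
  also have "\<dots> = rotate (N - k) (rotate k (x # ys'))" using eq \<open>k = k'\<close> by simp
  also have "\<dots> = x # ys'" by (rule rot) (simp add: N(3))
  finally show "ys = ys'" by simp
qed

lemma loop_visits_class:
  assumes "xs \<in> based_loops"
  shows "loop_visits (rotation_rel `` {xs}) F \<longleftrightarrow> set xs \<inter> F \<noteq> {}"
proof -
  have "xs \<in> rotation_rel `` {xs}" using assms by (auto simp: rotation_rel_def intro: exI[of _ 0])
  thus ?thesis by (auto simp: loop_visits_def rotation_rel_def)
qed

lemma sets_loop_measure: "sets (loop_measure \<kappa>) = Pow loops"
  by (simp add: loop_measure_def)

lemma emeasure_loop_measure:
  assumes "S \<subseteq> loops"
  shows "emeasure (loop_measure \<kappa>) S = (\<integral>\<^sup>+xs. ennreal (based_loop_weight \<kappa> xs) *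
    indicator {xs \<in> based_loops. rotation_rel `` {xs} \<in> S} xs \<partial>count_space UNIV)"
proof -
  let ?g = "\<lambda>xs. rotation_rel `` {xs}"
  have "?g \<in> measurable (based_loop_measure \<kappa>) (count_space loops)"
    by (auto simp: based_loop_measure_def point_measure_def measurable_def loops_def quotientI)
  hence "emeasure (loop_measure \<kappa>) S = emeasure (based_loop_measure \<kappa>) (?g -` S \<inter> based_loops)"
    unfolding loop_measure_def using assms
    by (subst emeasure_distr) (auto simp: based_loop_measure_def space_point_measure)
  also have "\<dots> = (\<integral>\<^sup>+xs. ennreal (based_loop_weight \<kappa> xs) * indicator (?g -` S \<inter> based_loops) xs \<partial>count_space based_loops)"
    unfolding based_loop_measure_def point_measure_def by (rule emeasure_density) auto
  also have "\<dots> = (\<integral>\<^sup>+xs. ennreal (based_loop_weight \<kappa> xs) *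
      indicator {xs \<in> based_loops. rotation_rel `` {xs} \<in> S} xs \<partial>count_space UNIV)"
    by (subst nn_integral_count_space_indicator) (auto simp: indicator_def intro!: nn_integral_cong)
  finally show ?thesis .
qed

text \<open>Every excursion contributes all rotations of one based loop; these are distinct because
  the origin is visited only once.\<close>
lemma excursion_sum_le_loop_measure:
  assumes "1 \<le> n"
  shows "excursion_sum (far n :: (int ^ 'd::finite) set) \<le> emeasure (loop_measure 0)
    {l \<in> loops. loop_visits l {0} \<and> loop_visits l (inner_boundary (lattice_box (0 :: int ^ 'd) n))}"
proof -
  let ?S = "{l \<in> loops. loop_visits l {0} \<and> loop_visits l (inner_boundary (lattice_box (0 :: int ^ 'd) n))}"
  define f where "f = (\<lambda>xs :: (int ^ 'd) list. ennreal (based_loop_weight 0 xs) *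
    indicator {xs \<in> based_loops. rotation_rel `` {xs} \<in> ?S} xs)"
  define E where "E = {ys :: (int ^ 'd) list. 0 \<notin> set ys \<and> set ys \<inter> far n \<noteq> {}}"
  \<comment> \<open>Pairs of an excursion and a rotation. Nonzero weight ensures that consecutive
    vertices are adjacent, so every rotation is a based loop.\<close>
  define T where "T = {p :: (int ^ 'd) list \<times> nat. fst p \<in> E \<and> path_weight 0 (fst p @ [0]) \<noteq> 0 \<and> snd p < Suc (length (fst p))}"
  let ?g = "\<lambda>p :: (int ^ 'd) list \<times> nat. rotate (snd p) (0 # fst p)"
  have f: "f (rotate k (0 # ys)) = ennreal (path_weight 0 (ys @ [0]) / real (Suc (length ys)))"
    if T: "(ys, k) \<in> T" for ys k
  proof -
    have w: "based_loop_weight 0 (rotate i (0 # ys)) = path_weight 0 (ys @ [0]) / real (Suc (length ys))" for i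
      by (simp only: based_loop_weight_rotate based_loop_weight_Cons) simp
    have pos: "path_weight 0 (ys @ [0]) \<noteq> 0" "set ys \<inter> far n \<noteq> {}" using T by (auto simp: T_def E_def)
    have "ys \<noteq> []" using pos by auto
    hence "2 \<le> length (rotate i (0 # ys))" for i by (cases ys) auto
    hence b: "rotate k (0 # ys) \<in> based_loops" by (intro based_loops_if_weight) (auto simp: w pos)
    \<comment> \<open>The closing step is dropped so that the crossing takes place inside the
      excursion.\<close>
    have "path_weight 0 ys \<noteq> 0" using pos by (simp add: path_weight_append)
    moreover have "sup_norm (0 :: int ^ 'd) < int n" using sup_norm_le_iff[of "0 :: int ^ 'd" 0] assms by simp
    ultimately have "set ys \<inter> inner_boundary (lattice_box 0 n) \<noteq> {}" using pos by (intro path_crosses_sphere)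
    hence "rotation_rel `` {rotate k (0 # ys)} \<in> ?S"
      using b by (auto simp: loop_visits_class loops_def quotientI)
    thus ?thesis using b by (simp add: f_def w)
  qed
  have "excursion_sum (far n :: (int ^ 'd) set) = (\<integral>\<^sup>+ys. ennreal (path_weight 0 (ys @ [0])) * indicator E ys \<partial>count_space UNIV)"
    by (simp add: excursion_sum_def E_def)
  also have "\<dots> = (\<integral>\<^sup>+ys. \<integral>\<^sup>+k. f (?g (ys, k)) * indicator T (ys, k) \<partial>count_space UNIV \<partial>count_space UNIV)"
  proof (rule nn_integral_cong)
    fix ys :: "(int ^ 'd) list"
    let ?w = "path_weight 0 (ys @ [0])" and ?N = "Suc (length ys)"
    show "ennreal ?w * indicator E ys = (\<integral>\<^sup>+k. f (?g (ys, k)) * indicator T (ys, k) \<partial>count_space UNIV)"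
    proof (cases "ys \<in> E \<and> ?w \<noteq> 0")
      case True
      hence mem: "(ys, k) \<in> T \<longleftrightarrow> k < ?N" for k by (simp add: T_def)
      have "(\<integral>\<^sup>+k. f (?g (ys, k)) * indicator T (ys, k) \<partial>count_space UNIV)
          = (\<integral>\<^sup>+k. ennreal (?w / real ?N) * indicator {..<?N} k \<partial>count_space UNIV)"
      proof (rule nn_integral_cong)
        fix k
        show "f (?g (ys, k)) * indicator T (ys, k) = ennreal (?w / real ?N) * indicator {..<?N} k"
          using f[of ys k] mem[of k] by (cases "k < ?N") (simp_all del: of_nat_Suc)
      qed
      \<comment> \<open>The number of rotations cancels the factor 1/n in the loop weight.\<close>
      also have "\<dots> = ennreal (?w / real ?N) * ennreal (real ?N)"
        by (subst nn_integral_cmult_indicator) (auto simp: ennreal_of_nat_eq_real_of_nat simp del: of_nat_Suc)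
      also have "\<dots> = ennreal ?w"
        by (subst ennreal_mult[symmetric]) (auto simp: path_weight_nonneg)
      finally show ?thesis using True by simp
    next
      case False
      hence "(ys, k) \<notin> T" for k by (auto simp: T_def)
      thus ?thesis using False by auto
    qed
  qed
  also have "\<dots> = (\<integral>\<^sup>+p. f (?g p) * indicator T p \<partial>count_space UNIV)"
    by (rule nn_integral_fst_count_space)
  also have "\<dots> \<le> (\<integral>\<^sup>+xs. f xs \<partial>count_space UNIV)"
  proof (rule nn_integral_count_space_inj_le, rule inj_onI)
    fix p q assume "p \<in> T" "q \<in> T" "?g p = ?g q"
    thus "p = q"
      using rotate_Cons_inject[of "snd p" 0 "fst p" "snd q" "fst q"]
      by (auto simp: T_def E_def prod_eq_iff)
  qed
  also have "\<dots> = emeasure (loop_measure 0) ?S"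
    unfolding f_def by (rule emeasure_loop_measure[symmetric]) auto
  finally show ?thesis .
qed


section \<open>The loop soup\<close>

text \<open>The bounds on closed paths are chained, and the two factors \<open>green 0\<close>,
  finite in dimension at least three, are divided out.\<close>

lemma loop_measure_lower_bound:
  assumes "3 \<le> CARD('d::finite)"
  shows "\<exists>C > 0. \<forall>n \<ge> 1.
    ennreal (C * (real n)\<^sup>2 / real n ^ CARD('d)) \<le> emeasure (loop_measure 0)
      {l \<in> loops. loop_visits l {0} \<and> loop_visits l (inner_boundary (lattice_box (0 :: int ^ 'd) n))}"
proof -
  let ?D = "CARD('d)"
  define c where "c = 256 * real ?D * (1 / 644 ^ 2) ^ ?D"
  define g where "g = enn2real (green (0 :: int ^ 'd))"
  have g: "green (0 :: int ^ 'd) = ennreal g"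
    unfolding g_def using green_origin_finite[OF assms] by (simp add: less_top)
  \<comment> \<open>The path of length zero contributes one, so division by \<open>g\<close> is
    legitimate.\<close>
  have "ennreal (srw_power 0 (0 :: int ^ 'd)) \<le> green (0 :: int ^ 'd)"
    unfolding green_def using sum_le_suminf[of "\<lambda>m. ennreal (srw_power m (0 :: int ^ 'd))" "{0}"] by simp
  hence g1: "1 \<le> g" by (simp add: g ennreal_ge_1)
  show ?thesis
  proof (intro exI[of _ "c / g\<^sup>2"] conjI allI impI)
    show "0 < c / g\<^sup>2" using g1 by (simp add: c_def)
    fix n :: nat assume n: "1 \<le> n"
    let ?F = "far n :: (int ^ 'd) set"
    define r where "r = c * (real n)\<^sup>2 / real n ^ ?D"
    have r0: "0 \<le> r" by (simp add: r_def c_def)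
    have "ennreal r \<le> returning_sum ?F"
      using returning_sum_far_lower_bound[OF n, where 'd='d] by (simp add: r_def c_def mult_ac)
    also have "\<dots> \<le> ennreal g * (excursion_sum ?F * ennreal g)"
      using returning_sum_le[OF zero_notin_far[OF n, where 'd='d]] by (simp add: g)
    finally have le: "ennreal r \<le> ennreal g * (excursion_sum ?F * ennreal g)" .
    have "ennreal (r / g\<^sup>2) \<le> excursion_sum ?F"
    proof (cases "excursion_sum ?F")
      case (real w)
      hence "ennreal r \<le> ennreal (g * (w * g))" using le g1 by (simp add: ennreal_mult)
      hence "r \<le> g * (w * g)" using real g1 r0 by (subst (asm) ennreal_le_iff) auto
      hence "r / g\<^sup>2 \<le> w" using g1 by (simp add: field_simps power2_eq_square)
      thus ?thesis using real by (simp add: ennreal_leI)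
    qed simp
    also have "\<dots> \<le> emeasure (loop_measure 0)
      {l \<in> loops. loop_visits l {0} \<and> loop_visits l (inner_boundary (lattice_box (0 :: int ^ 'd) n))}"
      by (rule excursion_sum_le_loop_measure[OF n])
    finally show "ennreal (c / g\<^sup>2 * (real n)\<^sup>2 / real n ^ ?D) \<le> emeasure (loop_measure 0)
      {l \<in> loops. loop_visits l {0} \<and> loop_visits l (inner_boundary (lattice_box (0 :: int ^ 'd) n))}"
      by (simp add: r_def mult.commute)
  qed
qed

lemma countable_loops: "countable (loops :: 'v::countable list set set)"
  unfolding loops_def quotient_def by (auto intro: countable_subset[OF _ countable_image])

section \<open>Points of a Poisson process in countable sets\<close>

context poisson_point_process
begin

lemma space_realisation: "\<omega> \<in> space \<Omega> \<Longrightarrow> space (N \<omega>) = space M"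
  using sets_realisation by (rule sets_eq_imp_space_eq)

text \<open>By countability, a set all of whose singletons are null is null itself; so absence of
  points is the same as count zero.\<close>

lemma ex_point_iff:
  assumes "\<omega> \<in> space \<Omega>" "countable S" "Pow S \<subseteq> sets M"
  shows "(\<exists>x\<in>points (N \<omega>). x \<in> S) \<longleftrightarrow> emeasure (N \<omega>) S \<noteq> 0"
proof -
  have S: "{x} \<in> sets (N \<omega>)" if "x \<in> S" for x
    using sets_realisation[OF assms(1)] assms(3) that by auto
  have "emeasure (N \<omega>) S = 0" if "\<And>x. x \<in> S \<Longrightarrow> emeasure (N \<omega>) {x} = 0"
  proof -
    have "(\<Union>x\<in>S. {x}) \<in> null_sets (N \<omega>)"
      using assms(2) S that by (intro null_sets_UN') (auto simp: null_sets_def)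
    thus ?thesis by auto
  qed
  moreover have "emeasure (N \<omega>) {x} \<le> emeasure (N \<omega>) S" if "x \<in> S" for x
    using that sets_realisation[OF assms(1)] assms(3) by (intro emeasure_mono) auto
  moreover have "x \<in> space (N \<omega>)" if "x \<in> S" for x
    using S[OF that] sets.sets_into_space by blast
  ultimately show ?thesis unfolding points_def by (auto simp: zero_less_iff_neq_zero)
qed

lemma measurable_ex_point:
  assumes "countable S" "Pow S \<subseteq> sets M"
  shows "{\<omega> \<in> space \<Omega>. \<exists>x\<in>points (N \<omega>). x \<in> S} \<in> events"
proof -
  have [measurable]: "(\<lambda>\<omega>. emeasure (N \<omega>) S) \<in> borel_measurable \<Omega>"
    by (rule measurable_count) (use assms in auto)
  have "{\<omega> \<in> space \<Omega>. \<exists>x\<in>points (N \<omega>). x \<in> S} = {\<omega> \<in> space \<Omega>. emeasure (N \<omega>) S \<noteq> 0}"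
    using ex_point_iff assms by blast
  thus ?thesis by simp
qed

text \<open>For finite intensity the count is zero with probability exp(-M(S)); for infinite
  intensity a point exists almost surely.\<close>

lemma prob_ex_point_ge:
  assumes "countable S" "Pow S \<subseteq> sets M" "0 \<le> m" "ennreal m \<le> emeasure M S"
  shows "1 - exp (- m) \<le> \<P>(\<omega> in \<Omega>. \<exists>x\<in>points (N \<omega>). x \<in> S)"
proof -
  have S: "S \<in> sets M" using assms(2) by auto
  have [measurable]: "(\<lambda>\<omega>. emeasure (N \<omega>) S) \<in> borel_measurable \<Omega>"
    by (rule measurable_count[OF S])
  have eq: "{\<omega> \<in> space \<Omega>. \<exists>x\<in>points (N \<omega>). x \<in> S} = {\<omega> \<in> space \<Omega>. \<not> emeasure (N \<omega>) S = 0}"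
    using ex_point_iff assms(1,2) by blast
  have neg: "\<P>(\<omega> in \<Omega>. \<not> emeasure (N \<omega>) S = 0) = 1 - \<P>(\<omega> in \<Omega>. emeasure (N \<omega>) S = 0)"
    by (rule prob_neg) measurable
  show ?thesis
  proof (cases "emeasure M S = \<infinity>")
    case True
    have "AE \<omega> in \<Omega>. \<not> emeasure (N \<omega>) S = 0"
      using infinite_count[OF S True] by eventually_elim auto
    hence "\<P>(\<omega> in \<Omega>. \<not> emeasure (N \<omega>) S = 0) = 1" by (subst prob_Collect_eq_1) auto
    thus ?thesis using eq by simp
  next
    case False
    hence fin: "emeasure M S < \<infinity>" by (simp add: less_top)
    have "emeasure M S = ennreal (measure M S)" using fin by (intro emeasure_eq_ennreal_measure) auto
    hence "m \<le> measure M S" using assms(3,4) by simp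
    moreover have "\<P>(\<omega> in \<Omega>. emeasure (N \<omega>) S = 0) = exp (- measure M S)"
      using poisson_count[OF S fin, of 0] by simp
    ultimately show ?thesis using eq neg by simp
  qed
qed

lemma AE_not_point:
  assumes "countable S" "Pow S \<subseteq> sets M" "emeasure M S = 0"
  shows "AE \<omega> in \<Omega>. \<forall>x\<in>points (N \<omega>). x \<notin> S"
proof -
  have S: "S \<in> sets M" using assms(2) by auto
  have [measurable]: "(\<lambda>\<omega>. emeasure (N \<omega>) S) \<in> borel_measurable \<Omega>"
    by (rule measurable_count[OF S])
  have "\<P>(\<omega> in \<Omega>. emeasure (N \<omega>) S = 0) = 1"
    using poisson_count[OF S, of 0] assms(3) by (simp add: measure_def)
  hence "AE \<omega> in \<Omega>. emeasure (N \<omega>) S = 0" by (subst (asm) prob_Collect_eq_1) auto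
  thus ?thesis using AE_space
    by eventually_elim (use ex_point_iff assms(1,2) in blast)
qed

end

section \<open>Loops connect the vertices they visit\<close>

lemma rotation_class_representative:
  assumes "l \<in> loops"
  obtains xs where "xs \<in> based_loops" "l = rotation_rel `` {xs}" "xs \<in> l"
proof -
  obtain xs where xs: "xs \<in> based_loops" "l = rotation_rel `` {xs}"
    using assms by (auto simp: loops_def quotient_def)
  moreover from this have "xs \<in> l" by (auto simp: rotation_rel_def intro: exI[of _ 0])
  ultimately show thesis by (rule that)
qed

text \<open>Loops may jump between distinct vertices that are not adjacent; such jumps do not open edges, but
  these loops almost surely do not occur.\<close>
definition degenerate_loops :: "(int ^ 'd::finite) list set set" where
  "degenerate_loops = {l \<in> loops. \<exists>xs\<in>l. based_loop_weight 0 xs = 0}"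

text \<open>The weight is invariant under rotation, so one vanishing representative makes the whole
  class null.\<close>

lemma emeasure_degenerate_loops:
  "emeasure (loop_measure 0) (degenerate_loops :: (int ^ 'd::finite) list set set) = 0"
proof -
  have "based_loop_weight 0 xs = 0" if "rotation_rel `` {xs} \<in> degenerate_loops" for xs :: "(int ^ 'd) list"
    using that by (auto simp: degenerate_loops_def rotation_rel_def based_loop_weight_rotate)
  hence "ennreal (based_loop_weight 0 xs) *
      indicator {xs \<in> based_loops. rotation_rel `` {xs} \<in> degenerate_loops} xs = 0" for xs :: "(int ^ 'd) list"
    by (cases "rotation_rel `` {xs} \<in> degenerate_loops") auto
  moreover have "(degenerate_loops :: (int ^ 'd) list set set) \<subseteq> loops" by (auto simp: degenerate_loops_def)
  ultimately show ?thesis by (simp only: emeasure_loop_measure nn_integral_const mult_zero_left)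
qed

text \<open>The loop is rotated to start at x and followed; nonzero weight makes consecutive
  vertices adjacent, so the traversed edges are open.\<close>

lemma connected_by_loop:
  assumes "l \<in> L" "l \<in> loops" "l \<notin> degenerate_loops" "loop_visits l {x}" "loop_visits l B"
  shows "connected_by L {x} B"
proof -
  obtain xs where xs: "xs \<in> based_loops" "l = rotation_rel `` {xs}" "xs \<in> l"
    by (rule rotation_class_representative[OF assms(2)])
  have w: "based_loop_weight 0 xs \<noteq> 0" using assms(2,3) xs by (auto simp: degenerate_loops_def)
  have "x \<in> set xs" using assms(4) loop_visits_class[OF xs(1)] xs(2) by auto
  then obtain i where i: "i < length xs" "xs ! i = x" by (auto simp: in_set_conv_nth)
  define ys where "ys = rotate i xs"
  have wy: "based_loop_weight 0 ys \<noteq> 0" using w by (simp add: ys_def based_loop_weight_rotate)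
  have "2 \<le> length xs" using xs(1) by (simp add: based_loops_def)
  hence "ys \<in> based_loops" using wy by (intro based_loops_if_weight) (auto simp: ys_def)
  hence yl: "ys \<in> l" using xs by (auto simp: rotation_rel_def ys_def)
  have y0: "ys ! 0 = x" using i nth_rotate[of 0 xs i] by (cases xs) (auto simp: ys_def)
  have path: "(x, ys ! j) \<in> (open_edges L)\<^sup>*" if "j < length ys" for j
    using that
  proof (induction j)
    case (Suc j)
    have "neighbours (ys ! j) (ys ! (Suc j mod length ys))"
      using Suc.prems by (intro based_loop_weight_neighbours wy) simp
    hence "neighbours (ys ! j) (ys ! Suc j)" using Suc.prems by simp
    moreover have "loop_traverses l {ys ! j, ys ! Suc j}"
      unfolding loop_traverses_def using yl Suc.prems by (intro bexI[of _ ys] exI[of _ j]) auto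
    ultimately have "(ys ! j, ys ! Suc j) \<in> open_edges L"
      using assms(1) by (auto simp: open_edges_def)
    thus ?case using Suc by (auto intro: rtrancl_into_rtrancl)
  qed (simp add: y0)
  have "set ys \<inter> B \<noteq> {}" using assms(5) loop_visits_class[OF xs(1)] xs(2) by (simp add: ys_def)
  then obtain j where "j < length ys" "ys ! j \<in> B" by (auto simp: in_set_conv_nth)
  thus ?thesis using path by (auto simp: connected_by_def)
qed

section \<open>Events of the loop soup and their probabilities\<close>

context
  fixes \<alpha> :: real and \<Omega> :: "'w measure" and \<L> :: "'w \<Rightarrow> (int ^ 'd::finite) list set measure"
  assumes soup: "loop_soup \<alpha> 0 \<Omega> \<L>"
begin

interpretation poisson_point_process \<Omega> "scale_measure (ennreal \<alpha>) (loop_measure 0)" \<L>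
  using soup by (simp add: loop_soup_def)

lemma points_subset_loops: "\<omega> \<in> space \<Omega> \<Longrightarrow> points (\<L> \<omega>) \<subseteq> loops"
  using space_realisation by (auto simp: points_def space_scale_measure loop_measure_def)

lemma measurable_ex_loop: "{\<omega> \<in> space \<Omega>. \<exists>l\<in>points (\<L> \<omega>). P l} \<in> events"
proof -
  have "{\<omega> \<in> space \<Omega>. \<exists>l\<in>points (\<L> \<omega>). P l} = {\<omega> \<in> space \<Omega>. \<exists>l\<in>points (\<L> \<omega>). l \<in> {l \<in> loops. P l}}"
    using points_subset_loops by blast
  moreover have "countable {l \<in> loops. P l}"
    using countable_loops by (rule countable_subset[rotated]) auto
  moreover have "Pow {l \<in> loops. P l} \<subseteq> sets (scale_measure (ennreal \<alpha>) (loop_measure 0))"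
    by (auto simp: sets_loop_measure)
  ultimately show ?thesis using measurable_ex_point[of "{l \<in> loops. P l}"] by (simp only:)
qed

lemma measurable_open_edge: "{\<omega> \<in> space \<Omega>. (x, y) \<in> open_edges (points (\<L> \<omega>))} \<in> events"
proof (cases "neighbours x y")
  case True
  thus ?thesis using measurable_ex_loop by (simp add: open_edges_def)
qed (simp add: open_edges_def)

text \<open>Connection is a countable union over end points, path lengths and intermediate vertices.
  Measurability is required to compare probabilities by almost sure inclusion.\<close>

lemma measurable_connected_by: "{\<omega> \<in> space \<Omega>. connected_by (points (\<L> \<omega>)) A B} \<in> events"
proof -
  have [measurable]: "Measurable.pred \<Omega> (\<lambda>\<omega>. (x, y) \<in> open_edges (points (\<L> \<omega>)))" for x y
    using measurable_open_edge by (simp add: pred_def)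
  have [measurable]: "Measurable.pred \<Omega> (\<lambda>\<omega>. (x, y) \<in> open_edges (points (\<L> \<omega>)) ^^ k)" for k x y
  proof (induction k arbitrary: y)
    case (Suc k)
    note [measurable] = Suc
    have "Measurable.pred \<Omega> (\<lambda>\<omega>. \<exists>z. (x, z) \<in> open_edges (points (\<L> \<omega>)) ^^ k \<and> (z, y) \<in> open_edges (points (\<L> \<omega>)))"
      by measurable
    thus ?case by (simp add: relcomp_unfold)
  qed simp
  have "Measurable.pred \<Omega> (\<lambda>\<omega>. \<exists>x. \<exists>y. x \<in> A \<and> y \<in> B \<and> (\<exists>k. (x, y) \<in> open_edges (points (\<L> \<omega>)) ^^ k))"
    by measurable
  thus ?thesis by (simp add: connected_by_def rtrancl_power pred_def Bex_def conj_ac)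
qed

text \<open>Inclusion of the events holds off the null event that a degenerate loop occurs.\<close>

lemma prob_connected_by_ge:
  "\<P>(\<omega> in \<Omega>. \<exists>l\<in>points (\<L> \<omega>). loop_visits l {x} \<and> loop_visits l B)
    \<le> \<P>(\<omega> in \<Omega>. connected_by (points (\<L> \<omega>)) {x} B)"
proof (rule finite_measure_mono_AE)
  have "AE \<omega> in \<Omega>. \<forall>l\<in>points (\<L> \<omega>). l \<notin> degenerate_loops"
  proof (rule AE_not_point)
    show "countable (degenerate_loops :: (int ^ 'd) list set set)"
      using countable_loops by (rule countable_subset[rotated]) (auto simp: degenerate_loops_def)
  qed (use emeasure_degenerate_loops in \<open>auto simp: sets_loop_measure degenerate_loops_def\<close>)
  thus "AE \<omega> in \<Omega>. \<omega> \<in> {\<omega> \<in> space \<Omega>. \<exists>l\<in>points (\<L> \<omega>). loop_visits l {x} \<and> loop_visits l B}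
      \<longrightarrow> \<omega> \<in> {\<omega> \<in> space \<Omega>. connected_by (points (\<L> \<omega>)) {x} B}"
    by eventually_elim (use points_subset_loops connected_by_loop in blast)
qed (rule measurable_connected_by)

lemma prob_ex_loop_ge:
  assumes "0 \<le> \<alpha>" "0 \<le> \<delta>" "ennreal \<delta> \<le> emeasure (loop_measure 0) {l \<in> loops. P l}"
  shows "1 - exp (- (\<alpha> * \<delta>)) \<le> \<P>(\<omega> in \<Omega>. \<exists>l\<in>points (\<L> \<omega>). P l)"
proof -
  have "1 - exp (- (\<alpha> * \<delta>)) \<le> \<P>(\<omega> in \<Omega>. \<exists>l\<in>points (\<L> \<omega>). l \<in> {l \<in> loops. P l})"
  proof (rule prob_ex_point_ge)
    show "countable {l \<in> loops. P l}"
      using countable_loops by (rule countable_subset[rotated]) auto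
    show "ennreal (\<alpha> * \<delta>) \<le> emeasure (scale_measure (ennreal \<alpha>) (loop_measure 0)) {l \<in> loops. P l}"
      using assms by (simp add: ennreal_mult mult_left_mono)
  qed (use assms in \<open>auto simp: sets_loop_measure\<close>)
  also have "{\<omega> \<in> space \<Omega>. \<exists>l\<in>points (\<L> \<omega>). l \<in> {l \<in> loops. P l}} = {\<omega> \<in> space \<Omega>. \<exists>l\<in>points (\<L> \<omega>). P l}"
    using points_subset_loops by blast
  finally show ?thesis .
qed

end

section \<open>From the loop measure to a bound linear in the intensity\<close>

text \<open>It follows from exp x \<ge> 1 + x and makes the Poisson probability linear in x,
  uniformly over x \<le> y.\<close>

lemma divide_le_one_minus_exp:
  fixes x y :: real
  assumes "0 \<le> x" "x \<le> y"
  shows "x / (1 + y) \<le> 1 - exp (- x)"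
proof -
  have "x / (1 + y) \<le> x / (1 + x)" using assms by (intro divide_left_mono mult_pos_pos) auto
  also have "\<dots> = 1 - 1 / (1 + x)" using assms by (simp add: field_simps)
  also have "\<dots> \<le> 1 - exp (- x)"
    using exp_ge_add_one_self[of x] assms by (simp add: exp_minus field_simps)
  finally show ?thesis .
qed

lemma power_int_two_minus:
  fixes x :: real
  assumes "1 \<le> x" "2 \<le> d"
  shows "x powi (2 - int d) = x\<^sup>2 / x ^ d" "0 < x powi (2 - int d)" "x powi (2 - int d) \<le> 1"
proof -
  show *: "x powi (2 - int d) = x\<^sup>2 / x ^ d"
    using assms by (subst power_int_diff) auto
  have "x\<^sup>2 \<le> x ^ d" using assms by (intro power_increasing) auto
  thus "0 < x powi (2 - int d)" "x powi (2 - int d) \<le> 1" unfolding * using assms by auto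
qed

text \<open>A probability is at most one while the lower bound is linear in \<alpha>, so a single
  constant can serve only intensities up to a fixed \<open>A\<close>.\<close>

theorem theorem1p2:
  fixes A :: real
  assumes "CARD('d::finite) \<ge> 3" and "A > 0"
  shows "\<exists>c::real. c > 0 \<and>
    (\<forall>(\<alpha>::real) (\<Omega>::'w measure) (\<L>::'w \<Rightarrow> (int ^ 'd) list set measure) (n::nat).
       0 < \<alpha> \<longrightarrow> \<alpha> \<le> A \<longrightarrow> loop_soup \<alpha> 0 \<Omega> \<L> \<longrightarrow> n \<ge> 1 \<longrightarrow>
         \<P>(\<omega> in \<Omega>. connected_by (points (\<L> \<omega>)) {0} (inner_boundary (lattice_box 0 n)))
           \<ge> \<P>(\<omega> in \<Omega>. \<exists>l \<in> points (\<L> \<omega>). loop_visits l {0} \<and> loop_visits l (inner_boundary (lattice_box 0 n)))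
       \<and> \<P>(\<omega> in \<Omega>. \<exists>l \<in> points (\<L> \<omega>). loop_visits l {0} \<and> loop_visits l (inner_boundary (lattice_box 0 n)))
           \<ge> \<alpha> * c * real n powi (2 - int CARD('d)))"
proof -
  obtain C where C: "0 < C" "\<forall>n \<ge> 1.
    ennreal (C * (real n)\<^sup>2 / real n ^ CARD('d)) \<le> emeasure (loop_measure 0)
      {l \<in> loops. loop_visits l {0} \<and> loop_visits l (inner_boundary (lattice_box (0 :: int ^ 'd) n))}"
    using loop_measure_lower_bound[OF assms(1)] by (elim exE conjE) (rule that)
  show ?thesis
  \<comment> \<open>The mean number of loops is at least x = \<alpha> C n^(2-d) \<le> A C;
    \<open>divide_le_one_minus_exp\<close> with y = A C produces the witness.\<close>
  proof (intro exI[of _ "C / (1 + A * C)"] conjI allI impI)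
    show "0 < C / (1 + A * C)" using C(1) assms(2) by (simp add: add_pos_pos)
    fix \<alpha> :: real and \<Omega> :: "'w measure" and \<L> :: "'w \<Rightarrow> (int ^ 'd) list set measure" and n :: nat
    assume \<alpha>: "0 < \<alpha>" "\<alpha> \<le> A" and soup: "loop_soup \<alpha> 0 \<Omega> \<L>" and n: "1 \<le> n"
    show "\<P>(\<omega> in \<Omega>. \<exists>l\<in>points (\<L> \<omega>). loop_visits l {0} \<and> loop_visits l (inner_boundary (lattice_box 0 n)))
        \<le> \<P>(\<omega> in \<Omega>. connected_by (points (\<L> \<omega>)) {0} (inner_boundary (lattice_box 0 n)))"
      by (rule prob_connected_by_ge[OF soup])
    define e where "e = real n powi (2 - int CARD('d))"
    have e: "e = (real n)\<^sup>2 / real n ^ CARD('d)" and e1: "0 < e" "e \<le> 1"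
      using power_int_two_minus[of "real n" "CARD('d)"] n assms(1) unfolding e_def by linarith+
    define x where "x = \<alpha> * (C * e)"
    have x: "0 \<le> x"
      unfolding x_def using \<alpha>(1) C(1) e1(1) by (intro mult_nonneg_nonneg) linarith+
    have "C * e \<le> C * 1"
      using e1(2) C(1) by (intro mult_left_mono) linarith+
    hence xA: "x \<le> A * C"
      unfolding x_def using \<alpha> C(1) e1(1) assms(2) by (intro mult_mono) (auto intro: mult_nonneg_nonneg)
    have "\<alpha> * (C / (1 + A * C)) * e = x / (1 + A * C)" by (simp add: x_def)
    also have "\<dots> \<le> 1 - exp (- x)" by (rule divide_le_one_minus_exp[OF x xA])
    also have "\<dots> \<le> \<P>(\<omega> in \<Omega>. \<exists>l\<in>points (\<L> \<omega>). loop_visits l {0} \<and> loop_visits l (inner_boundary (lattice_box 0 n)))"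
      unfolding x_def
    proof (rule prob_ex_loop_ge[OF soup])
      show "ennreal (C * e) \<le> emeasure (loop_measure 0)
        {l \<in> loops. loop_visits l {0} \<and> loop_visits l (inner_boundary (lattice_box (0 :: int ^ 'd) n))}"
        using C(2)[rule_format, OF n] by (simp only: e times_divide_eq_right)
    qed (use \<alpha> C(1) e1 in auto)
    finally show "\<alpha> * (C / (1 + A * C)) * real n powi (2 - int CARD('d))
      \<le> \<P>(\<omega> in \<Omega>. \<exists>l\<in>points (\<L> \<omega>). loop_visits l {0} \<and> loop_visits l (inner_boundary (lattice_box 0 n)))"
      by (simp only: e_def)
  qed
qed

end
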